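(* Let $0<a<b$ and $A=\{x\in\mathbb{R}^2 : a<|x|<b\}$. For any $p>1$, the problem $$-\Delta u=\frac{u^p(x)}{|x|^2}\ (x\in A),\qquad u(x)>0\ (x\in A),\qquad u(x)=0\ (x\in\partial A)$$ admits a unique radially symmetric solution $u_p(x)=u_p(|x|)$. Furthermore, as $p\to\infty$, $$u_p(|x|)\to\frac{2}{\log b-\log a}\begin{cases}\log|x|-\log a, & a\le|x|\le\sqrt{ab},\\ \log b-\log|x|, & \sqrt{ab}\le|x|\le b,\end{cases}$$ in $C^0(\overline{A})$, and, as $p\searrow 1$, $$u_p(|x|)=\left(\frac{2}{\log b-\log a}\right)^{\frac{2}{p-1}}\left(\frac{p+1}{2}\right)^{\frac{1}{p-1}}L_p^{\frac{2}{p-1}}\left[\sin\left(\frac{\pi(\log b-\log|x|)}{\log b-\log a}\right)+o_p(1)\right]$$ in $C^0(\overline{A})$, where $o_p(1)$ denotes a function on $\overline{A}$ (depending on $p$) with $o_p(1)\to 0$ in $C^0(\overline{A})$ as $p\searrow 1$.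
   Context: For $p>0$, $L_p=\int_0^1\frac{ds}{\sqrt{1-s^{p+1}}}$. Solutions are understood in the classical sense, $u\in C^2(A)\cap C^0(\overline{A})$. Convergence in $C^0(\overline{A})$ means uniform convergence on $\overline{A}$. A radially symmetric function is identified with a function of $r=|x|$. *)

theory Defs
  imports "HOL-Analysis.Analysis"
begin

definition partial_deriv :: "'n::finite \<Rightarrow> (real^'n \<Rightarrow> real) \<Rightarrow> real^'n \<Rightarrow> real" where
  "partial_deriv i u x = deriv (\<lambda>t. u (x + t *\<^sub>R axis i 1)) 0"

definition has_partial_deriv_at :: "'n::finite \<Rightarrow> (real^'n \<Rightarrow> real) \<Rightarrow> real^'n \<Rightarrow> bool" where
  "has_partial_deriv_at i u x \<longleftrightarrow> (\<lambda>t. u (x + t *\<^sub>R axis i 1)) field_differentiable at 0"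

text \<open>Meant for open sets \<open>A\<close>: then only the values of \<open>u\<close> on \<open>A\<close> matter.\<close>

definition C2_on :: "(real^'n::finite) set \<Rightarrow> (real^'n \<Rightarrow> real) \<Rightarrow> bool" where
  "C2_on A u \<longleftrightarrow>
     continuous_on A u \<and>
     (\<forall>i. (\<forall>x\<in>A. has_partial_deriv_at i u x) \<and> continuous_on A (partial_deriv i u)) \<and>
     (\<forall>i j. (\<forall>x\<in>A. has_partial_deriv_at j (partial_deriv i u) x) \<and>
            continuous_on A (partial_deriv j (partial_deriv i u)))"

definition laplacian :: "(real^'n::finite \<Rightarrow> real) \<Rightarrow> real^'n \<Rightarrow> real" where
  "laplacian u x = (\<Sum>i\<in>UNIV. partial_deriv i (partial_deriv i u) x)"

definition annulus :: "real \<Rightarrow> real \<Rightarrow> (real^2) set" where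
  "annulus a b = {x. a < norm x \<and> norm x < b}"

definition classical_solution :: "real \<Rightarrow> real \<Rightarrow> real \<Rightarrow> (real^2 \<Rightarrow> real) \<Rightarrow> bool" where
  "classical_solution a b p u \<longleftrightarrow>
     C2_on (annulus a b) u \<and>
     continuous_on (closure (annulus a b)) u \<and>
     (\<forall>x\<in>annulus a b. - laplacian u x = u x powr p / (norm x)\<^sup>2) \<and>
     (\<forall>x\<in>annulus a b. u x > 0) \<and>
     (\<forall>x\<in>frontier (annulus a b). u x = 0)"

definition radially_symmetric_on :: "(real^'n::finite) set \<Rightarrow> (real^'n \<Rightarrow> real) \<Rightarrow> bool" where
  "radially_symmetric_on S u \<longleftrightarrow> (\<forall>x\<in>S. \<forall>y\<in>S. norm x = norm y \<longrightarrow> u x = u y)"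

definition radial_solution :: "real \<Rightarrow> real \<Rightarrow> real \<Rightarrow> (real^2 \<Rightarrow> real) \<Rightarrow> bool" where
  "radial_solution a b p u \<longleftrightarrow>
     classical_solution a b p u \<and> radially_symmetric_on (closure (annulus a b)) u"

text \<open>The integrand is singular at \<open>s = 1\<close>, where division by zero gives it the value \<open>0\<close>;
  the gauge integral covers the improper integral.\<close>

definition L_const :: "real \<Rightarrow> real" where
  "L_const p = integral {0..1} (\<lambda>s. 1 / sqrt (1 - s powr (p + 1)))"

end

theory Submission
  imports Defs "HOL-Real_Asymp.Real_Asymp"
begin

text \<open>
  In the variable \<open>t = ln |x|\<close> the planar Laplacian of a radial function \<open>w (ln |x|)\<close> is
  \<open>w''(t) / |x|\<^sup>2\<close>, so the weight \<open>1 / |x|\<^sup>2\<close> cancels and radial solutions correspond to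
  positive solutions of the autonomous problem \<open>w'' = - w\<^sup>p\<close> on \<open>(ln a, ln b)\<close> with zero boundary
  values (lemma \<open>radial_laplacian\<close>).

  That problem is solved by quadrature. Put \<open>F y = \<integral>\<^sub>0\<^sup>y ds / sqrt (1 - s\<^bsup>p+1\<^esup>)\<close>, so that
  \<open>F 1 = L\<^sub>p\<close>, and let \<open>S\<close> be its inverse, a generalised sine. If \<open>M\<close> is the maximum of a
  solution \<open>w\<close>, conservation of energy says that \<open>F (w / M)\<close> has constant slope \<open>\<kappa>\<close> before the
  maximum point and slope \<open>- \<kappa>\<close> after it, where \<open>\<kappa>\<^sup>2 = 2 M\<^bsup>p-1\<^esup> / (p + 1)\<close>. It climbs from \<open>0\<close> to
  \<open>L\<^sub>p\<close> and back with the same speed, hence the maximum point is the midpoint,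
  \<open>\<kappa> (ln b - ln a) = 2 L\<^sub>p\<close> determines \<open>M\<close>, and \<open>w\<close> is \<open>M\<close> times the arch formed by \<open>S\<close> and its
  mirror image (lemma \<open>profile_unique\<close>). Conversely this arch is twice differentiable, also at its
  top, and solves the equation (lemmas \<open>profile_has_deriv\<close>, \<open>profile_deriv_has_deriv\<close>).

  With this formula both limits reduce to limits of \<open>F\<close>. The differences \<open>F y - y\<close> and
  \<open>arcsin y - F y\<close> are nondecreasing on \<open>[0, 1]\<close>, so they are bounded by their values
  \<open>L\<^sub>p - 1\<close> and \<open>pi / 2 - L\<^sub>p\<close> at \<open>1\<close>, and \<open>S\<close> is uniformly that close to the identity and to the
  sine. Two more comparisons with explicit primitives give
  \<open>sqrt (2 / (p + 1)) pi / 2 \<le> L\<^sub>p \<le> 1 + 2 / (p + 1)\<close>, whence \<open>L\<^sub>p\<close> tends to \<open>pi / 2\<close> as \<open>p\<close>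
  decreases to \<open>1\<close> and to \<open>1\<close> as \<open>p\<close> tends to infinity.
\<close>

section \<open>The generalised arcsine and its value at one\<close>

definition gen_arcsin :: "real \<Rightarrow> real \<Rightarrow> real" where
  "gen_arcsin p y = integral {0..y} (\<lambda>s. 1 / sqrt (1 - s powr (p + 1)))"

lemma gen_arcsin_0 [simp]: "gen_arcsin p 0 = 0"
  by (simp add: gen_arcsin_def)

lemma gen_arcsin_1 [simp]: "gen_arcsin p 1 = L_const p"
  by (simp add: gen_arcsin_def L_const_def)

lemma powr_less_one_unit:
  fixes s e :: real
  assumes "0 \<le> s" "s < 1" "0 < e"
  shows "s powr e < 1"
  using powr_less_mono2[of e s 1] assms by simp

lemma gen_arcsin_integrand_le:
  assumes "1 < p" "s \<in> {0..1}"
  shows "1 / sqrt (1 - s powr (p + 1)) \<le> 1 / sqrt (1 - s\<^sup>2)"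
proof (cases "s = 1")
  case False
  have "s powr (p + 1) \<le> s powr 2"
    using assms by (intro powr_mono') auto
  also have "s powr 2 = s\<^sup>2" using assms by (cases "s = 0") (auto simp: powr_numeral)
  finally have le: "s powr (p + 1) \<le> s\<^sup>2" .
  have "s\<^sup>2 < 1" using assms False by (simp add: abs_square_less_1)
  then show ?thesis using le by (intro divide_left_mono mult_pos_pos) auto
qed simp

text \<open>The integrand is unbounded at \<open>1\<close>; it is dominated by the derivative of \<open>arcsin\<close>, whose
  integral exists because \<open>arcsin\<close> is continuous up to the endpoint.\<close>

lemma gen_arcsin_integrable:
  assumes "1 < p"
  shows "(\<lambda>s. 1 / sqrt (1 - s powr (p + 1))) integrable_on {0..1}"
proof (rule measurable_bounded_by_integrable_imp_integrable_real)
  show "(\<lambda>s. 1 / sqrt (1 - s powr (p + 1))) \<in> borel_measurable (lebesgue_on {0..1})"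
    by (intro borel_measurable_if_D measurable_completion measurable_restrict_space1) measurable
  have "((\<lambda>s. 1 / sqrt (1 - s\<^sup>2)) has_integral arcsin 1 - arcsin 0) {0..1}"
    by (rule fundamental_theorem_of_calculus_interior)
       (auto intro!: continuous_on_arcsin' DERIV_arcsin continuous_intros
             simp: divide_inverse simp flip: has_real_derivative_iff_has_vector_derivative)
  then show "(\<lambda>s. 1 / sqrt (1 - s\<^sup>2)) integrable_on {0..1::real}" by blast
next
  fix s :: real assume s: "s \<in> {0..1}"
  then have "s powr (p + 1) \<le> 1" using assms by (intro powr_le1) auto
  then show "\<bar>1 / sqrt (1 - s powr (p + 1))\<bar> \<le> 1 / sqrt (1 - s\<^sup>2)"
    using gen_arcsin_integrand_le[OF assms s] by simp
qed auto

lemma continuous_on_gen_arcsin: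
  assumes "1 < p"
  shows "continuous_on {0..1} (gen_arcsin p)"
  unfolding gen_arcsin_def by (rule indefinite_integral_continuous_1[OF gen_arcsin_integrable[OF assms]])

lemma gen_arcsin_deriv:
  assumes "1 < p" "0 < y" "y < 1"
  shows "(gen_arcsin p has_real_derivative 1 / sqrt (1 - y powr (p + 1))) (at y)"
proof -
  define c where "c = (y + 1) / 2"
  have c: "y < c" "c < 1" using assms by (auto simp: c_def)
  have "continuous_on {0..c} (\<lambda>s. s powr (p + 1))"
    using assms by (intro continuous_on_powr' continuous_intros) auto
  then have "continuous_on {0..c} (\<lambda>s. 1 / sqrt (1 - s powr (p + 1)))"
  proof (intro continuous_on_divide continuous_on_real_sqrt continuous_on_diff continuous_on_const ballI)
    fix s assume "s \<in> {0..c}"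
    then show "sqrt (1 - s powr (p + 1)) \<noteq> 0"
      using powr_less_one_unit[of s "p + 1"] c assms by auto
  qed (use assms c in auto)
  from integral_has_real_derivative[OF this, of y]
  have "(gen_arcsin p has_real_derivative 1 / sqrt (1 - y powr (p + 1))) (at y within {0..c})"
    using assms c unfolding gen_arcsin_def[abs_def] by simp
  then show ?thesis using assms c by (simp add: at_within_Icc_at)
qed

text \<open>The integrand is at least \<open>1\<close>, so \<open>F y - y\<close> is nondecreasing. This yields strict monotonicity of
  \<open>F\<close> and, later, the uniform distance between \<open>F\<close> and the identity. The comparison is made through
  derivatives on the open interval, as the integrand takes the default value \<open>0\<close> at \<open>1\<close>.\<close>

lemma gen_arcsin_diff_mono:
  assumes "1 < p" "0 \<le> y" "y \<le> z" "z \<le> 1"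
  shows "z - y \<le> gen_arcsin p z - gen_arcsin p y"
proof -
  have "gen_arcsin p y - y \<le> gen_arcsin p z - z"
  proof (rule DERIV_nonneg_imp_increasing_open[OF assms(3)])
    fix x assume x: "y < x" "x < z"
    have "((\<lambda>x. gen_arcsin p x - x) has_real_derivative 1 / sqrt (1 - x powr (p + 1)) - 1) (at x)"
      using x assms by (intro derivative_intros gen_arcsin_deriv) auto
    moreover have "1 / sqrt (1 - x powr (p + 1)) \<ge> 1"
      using x assms powr_less_one_unit[of x "p + 1"] by simp
    ultimately show "\<exists>y. ((\<lambda>x. gen_arcsin p x - x) has_real_derivative y) (at x) \<and> y \<ge> 0"
      using diff_ge_0_iff_ge by blast
  next
    show "continuous_on {y..z} (\<lambda>x. gen_arcsin p x - x)"
      using assms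
      by (intro continuous_intros continuous_on_subset[OF continuous_on_gen_arcsin[of p]]) auto
  qed
  then show ?thesis by linarith
qed

text \<open>For \<open>p > 1\<close> the exponent \<open>p + 1\<close> exceeds \<open>2\<close>, so the integrand lies below that of \<open>arcsin\<close>.\<close>

lemma gen_arcsin_diff_le_arcsin:
  assumes "1 < p" "0 \<le> y" "y \<le> z" "z \<le> 1"
  shows "gen_arcsin p z - gen_arcsin p y \<le> arcsin z - arcsin y"
proof -
  have "arcsin y - gen_arcsin p y \<le> arcsin z - gen_arcsin p z"
  proof (rule DERIV_nonneg_imp_increasing_open[OF assms(3)])
    fix x assume x: "y < x" "x < z"
    have "((\<lambda>x. arcsin x - gen_arcsin p x) has_real_derivative
        inverse (sqrt (1 - x\<^sup>2)) - 1 / sqrt (1 - x powr (p + 1))) (at x)"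
      using x assms by (intro derivative_intros gen_arcsin_deriv DERIV_arcsin) auto
    moreover have "inverse (sqrt (1 - x\<^sup>2)) \<ge> 1 / sqrt (1 - x powr (p + 1))"
      using x assms gen_arcsin_integrand_le[of p x] by (simp add: divide_inverse)
    ultimately show "\<exists>y. ((\<lambda>x. arcsin x - gen_arcsin p x) has_real_derivative y) (at x) \<and> y \<ge> 0"
      using diff_ge_0_iff_ge by blast
  next
    show "continuous_on {y..z} (\<lambda>x. arcsin x - gen_arcsin p x)"
      using assms
      by (intro continuous_intros continuous_on_subset[OF continuous_on_gen_arcsin[of p]]) auto
  qed
  then show ?thesis by linarith
qed

lemma L_const_le_pi_half: "1 < p \<Longrightarrow> L_const p \<le> pi / 2"
  using gen_arcsin_diff_le_arcsin[of p 0 1] by simp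

lemma L_const_ge_1: "1 < p \<Longrightarrow> 1 \<le> L_const p"
  using gen_arcsin_diff_mono[of p 0 1] by simp

lemma L_const_pos: "1 < p \<Longrightarrow> 0 < L_const p"
  using L_const_ge_1[of p] by linarith

text \<open>Young's inequality gives \<open>1 - s\<^bsup>p+1\<^esup> \<le> (p + 1) / 2 * (1 - s\<^sup>2)\<close>, so the integrand is at least
  \<open>sqrt (2 / (p + 1))\<close> times that of \<open>arcsin\<close>.\<close>

lemma L_const_ge:
  assumes "1 < p"
  shows "sqrt (2 / (p + 1)) * (pi / 2) \<le> L_const p"
proof -
  define c where "c = sqrt (2 / (p + 1))"
  define G where "G = (\<lambda>x. gen_arcsin p x - c * arcsin x)"
  have "G 0 \<le> G 1"
  proof (rule DERIV_nonneg_imp_increasing_open[where f = G])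
    fix x :: real assume x: "0 < x" "x < 1"
    have "(G has_real_derivative
        1 / sqrt (1 - x powr (p + 1)) - c * inverse (sqrt (1 - x\<^sup>2))) (at x)"
      unfolding G_def
      using x assms by (auto intro!: derivative_eq_intros gen_arcsin_deriv DERIV_arcsin)
    moreover have "c * inverse (sqrt (1 - x\<^sup>2)) \<le> 1 / sqrt (1 - x powr (p + 1))"
    proof -
      have x2: "x\<^sup>2 < 1" using x by (simp add: abs_square_less_1)
      have "x\<^sup>2 = (x powr (p + 1)) powr (2 / (p + 1)) * 1 powr (1 - 2 / (p + 1))"
      proof -
        have "(p + 1) * (2 / (p + 1)) = 2" using assms by (simp add: field_simps)
        then show ?thesis using x by (simp add: powr_powr powr_numeral del: times_divide_eq_right)
      qed
      also have "\<dots> \<le> 2 / (p + 1) * x powr (p + 1) + (1 - 2 / (p + 1)) * 1"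
        by (rule Youngs_inequality_0) (use x assms in auto)
      finally have "2 / (p + 1) * (1 - x powr (p + 1)) \<le> 1 - x\<^sup>2"
        by (simp add: algebra_simps diff_divide_distrib)
      then have "c * sqrt (1 - x powr (p + 1)) \<le> sqrt (1 - x\<^sup>2)"
        unfolding c_def real_sqrt_mult[symmetric] by (rule real_sqrt_le_mono)
      then show ?thesis
        using x2 x powr_less_one_unit[of x "p + 1"] assms by (simp add: field_simps)
    qed
    ultimately show "\<exists>y. (G has_real_derivative y) (at x) \<and> y \<ge> 0"
      using diff_ge_0_iff_ge by blast
  next
    show "continuous_on {0..1} G"
      unfolding G_def using assms by (intro continuous_intros continuous_on_gen_arcsin) auto
  qed simp
  then show ?thesis by (simp add: G_def c_def)
qed

text \<open>Since \<open>1 - sqrt (1 - x) \<le> x\<close>, the integrand exceeds \<open>1\<close> by at most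
  \<open>s\<^bsup>p\<^esup> / sqrt (1 - s\<^bsup>p+1\<^esup>)\<close>, which has the primitive \<open>- 2 / (p + 1) * sqrt (1 - s\<^bsup>p+1\<^esup>)\<close>.\<close>

lemma L_const_le:
  assumes "1 < p"
  shows "L_const p \<le> 1 + 2 / (p + 1)"
proof -
  define G where "G = (\<lambda>y. y - 2 / (p + 1) * sqrt (1 - y powr (p + 1)) - gen_arcsin p y)"
  have "G 0 \<le> G 1"
  proof (rule DERIV_nonneg_imp_increasing_open[where f = G])
    fix x :: real assume x: "0 < x" "x < 1"
    define r where "r = sqrt (1 - x powr (p + 1))"
    have q: "x powr (p + 1) < 1" using powr_less_one_unit[of x "p + 1"] x assms by simp
    then have r: "0 < r" "r\<^sup>2 = 1 - x powr (p + 1)" by (auto simp: r_def)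
    have r1: "r \<le> 1" by (simp add: r_def)
    have "(G has_real_derivative 1 + x powr p / r - 1 / r) (at x)"
    proof -
      have "((\<lambda>y. y powr (p + 1)) has_real_derivative (p + 1) * x powr p) (at x)"
        using has_real_derivative_powr[of x "p + 1"] x by simp
      then have "((\<lambda>y. sqrt (1 - y powr (p + 1))) has_real_derivative
          - ((p + 1) * x powr p) / (2 * r)) (at x)"
        using q x by (auto intro!: derivative_eq_intros simp: r_def field_simps)
      then have "(G has_real_derivative
          1 - 2 / (p + 1) * (- ((p + 1) * x powr p) / (2 * r)) - 1 / r) (at x)"
        unfolding G_def r_def using x assms by (intro DERIV_diff DERIV_cmult DERIV_ident gen_arcsin_deriv) auto
      also have "1 - 2 / (p + 1) * (- ((p + 1) * x powr p) / (2 * r)) - 1 / r = 1 + x powr p / r - 1 / r"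
        using assms by simp
      finally show ?thesis .
    qed
    moreover have "0 \<le> 1 + x powr p / r - 1 / r"
    proof -
      have "x powr (p + 1) \<le> x powr p" using x by (intro powr_mono') auto
      moreover have "r\<^sup>2 \<le> r" using r r1 mult_left_le[of r r] by (simp only: power2_eq_square)
      ultimately have "1 \<le> r + x powr p" using r by linarith
      then have "0 \<le> (r + x powr p - 1) / r" using r by simp
      also have "\<dots> = 1 + x powr p / r - 1 / r"
        using r by (simp add: diff_divide_distrib add_divide_distrib)
      finally show ?thesis .
    qed
    ultimately show "\<exists>y. (G has_real_derivative y) (at x) \<and> y \<ge> 0" by blast
    next
    show "continuous_on {0..1} G"
      unfolding G_def using assms
      by (intro continuous_intros continuous_on_powr' continuous_on_gen_arcsin) auto
  qed simp
  then show ?thesis by (simp add: G_def)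
qed

lemma L_const_tendsto_pi_half: "(L_const \<longlongrightarrow> pi / 2) (at_right 1)"
proof (rule tendsto_sandwich)
  show "\<forall>\<^sub>F p in at_right 1. sqrt (2 / (p + 1)) * (pi / 2) \<le> L_const p"
    using eventually_at_right_less[of "1::real"] by eventually_elim (rule L_const_ge)
  show "\<forall>\<^sub>F p in at_right 1. L_const p \<le> pi / 2"
    using eventually_at_right_less[of "1::real"] by eventually_elim (rule L_const_le_pi_half)
  show "((\<lambda>p. sqrt (2 / (p + 1)) * (pi / 2)) \<longlongrightarrow> pi / 2) (at_right (1::real))"
    by (auto intro!: tendsto_eq_intros)
qed simp

lemma L_const_tendsto_1: "(L_const \<longlongrightarrow> 1) at_top"
proof (rule tendsto_sandwich)
  show "\<forall>\<^sub>F p in at_top. 1 \<le> L_const p"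
    using eventually_gt_at_top[of "1::real"] by eventually_elim (rule L_const_ge_1)
  show "\<forall>\<^sub>F p in at_top. L_const p \<le> 1 + 2 / (p + 1)"
    using eventually_gt_at_top[of "1::real"] by eventually_elim (rule L_const_le)
  show "((\<lambda>p. 1 + 2 / (p + 1)) \<longlongrightarrow> 1) (at_top :: real filter)" by real_asymp
qed simp

section \<open>The generalised sine and its arch\<close>

definition gen_sin :: "real \<Rightarrow> real \<Rightarrow> real" where
  "gen_sin p = inv_into {0..1} (gen_arcsin p)"

lemma gen_arcsin_strict_mono:
  assumes "1 < p" "0 \<le> y" "y < z" "z \<le> 1"
  shows "gen_arcsin p y < gen_arcsin p z"
  using gen_arcsin_diff_mono[of p y z] assms by linarith

lemma inj_on_gen_arcsin: "1 < p \<Longrightarrow> inj_on (gen_arcsin p) {0..1}"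
  by (rule linorder_inj_onI') (use gen_arcsin_strict_mono[of p] in force)

lemma gen_arcsin_image:
  assumes "1 < p"
  shows "gen_arcsin p ` {0..1} = {0..L_const p}"
proof
  show "gen_arcsin p ` {0..1} \<subseteq> {0..L_const p}"
  proof (rule image_subsetI)
    fix y :: real assume "y \<in> {0..1}"
    then show "gen_arcsin p y \<in> {0..L_const p}"
      using gen_arcsin_diff_mono[of p 0 y] gen_arcsin_diff_mono[of p y 1] assms by simp
  qed
  show "{0..L_const p} \<subseteq> gen_arcsin p ` {0..1}"
  proof
    fix z assume "z \<in> {0..L_const p}"
    then show "z \<in> gen_arcsin p ` {0..1}"
      using IVT'[of "gen_arcsin p" 0 z 1] continuous_on_gen_arcsin[OF assms] by fastforce
  qed
qed

lemma gen_arcsin_gen_sin: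
  "1 < p \<Longrightarrow> 0 \<le> z \<Longrightarrow> z \<le> L_const p \<Longrightarrow> gen_arcsin p (gen_sin p z) = z"
  unfolding gen_sin_def by (rule f_inv_into_f) (simp add: gen_arcsin_image)

lemma gen_sin_gen_arcsin:
  "1 < p \<Longrightarrow> 0 \<le> y \<Longrightarrow> y \<le> 1 \<Longrightarrow> gen_sin p (gen_arcsin p y) = y"
  unfolding gen_sin_def by (simp add: inv_into_f_f inj_on_gen_arcsin)

lemma gen_sin_mem:
  assumes "1 < p" "0 \<le> z" "z \<le> L_const p"
  shows "gen_sin p z \<in> {0..1}"
  unfolding gen_sin_def by (rule inv_into_into) (use assms gen_arcsin_image in auto)

lemma gen_sin_0: "1 < p \<Longrightarrow> gen_sin p 0 = 0"
  using gen_sin_gen_arcsin[of p 0] by simp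

lemma gen_sin_L: "1 < p \<Longrightarrow> gen_sin p (L_const p) = 1"
  using gen_sin_gen_arcsin[of p 1] by simp

lemma gen_sin_pos:
  assumes "1 < p" "0 < z" "z \<le> L_const p"
  shows "0 < gen_sin p z"
  using gen_sin_mem[of p z] gen_arcsin_gen_sin[of p z] assms
  by (cases "gen_sin p z = 0") auto

lemma gen_sin_less_1:
  assumes "1 < p" "0 \<le> z" "z < L_const p"
  shows "gen_sin p z < 1"
  using gen_sin_mem[of p z] gen_arcsin_gen_sin[of p z] assms
  by (cases "gen_sin p z = 1") auto

lemma continuous_on_gen_sin:
  assumes "1 < p"
  shows "continuous_on {0..L_const p} (gen_sin p)"
  using continuous_on_inv[OF continuous_on_gen_arcsin[OF assms] compact_Icc, of "gen_sin p"]
    gen_sin_gen_arcsin[OF assms] by (simp add: gen_arcsin_image[OF assms])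

lemma gen_sin_deriv:
  assumes "1 < p" "0 < z" "z < L_const p"
  shows "(gen_sin p has_real_derivative sqrt (1 - gen_sin p z powr (p + 1))) (at z)"
proof -
  define y where "y = gen_sin p z"
  have y: "0 < y" "y < 1" using gen_sin_pos gen_sin_less_1 assms by (auto simp: y_def)
  have "(gen_sin p has_real_derivative inverse (1 / sqrt (1 - y powr (p + 1)))) (at z)"
  proof (rule DERIV_inverse_function)
    show "(gen_arcsin p has_real_derivative 1 / sqrt (1 - y powr (p + 1))) (at (gen_sin p z))"
      using gen_arcsin_deriv y assms by (simp add: y_def)
    show "1 / sqrt (1 - y powr (p + 1)) \<noteq> 0"
      using powr_less_one_unit[of y "p + 1"] y assms by simp
    show "isCont (gen_sin p) z"
      using continuous_on_interior[OF continuous_on_gen_sin[OF assms(1)]] assms by simp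
  qed (use assms gen_arcsin_gen_sin in auto)
  then show ?thesis by (simp add: y_def)
qed

text \<open>Two copies of \<open>gen_sin p\<close>, the second one mirrored, form one arch over \<open>[0, 2 L\<^sub>p]\<close>;
  \<open>gen_cos_arch\<close> is its slope.\<close>

definition gen_sin_arch :: "real \<Rightarrow> real \<Rightarrow> real" where
  "gen_sin_arch p z = gen_sin p (min z (2 * L_const p - z))"

definition gen_cos_arch :: "real \<Rightarrow> real \<Rightarrow> real" where
  "gen_cos_arch p z = sgn (L_const p - z) * sqrt (1 - gen_sin_arch p z powr (p + 1))"

text \<open>Used to glue the two halves of the arch: the derivative is known on either side of the top, and its
  continuous extension is the derivative at the top as well, because \<open>f\<close> is a primitive of \<open>g\<close>
  across a single exceptional point.\<close>

lemma DERIV_removable: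
  fixes f g :: "real \<Rightarrow> real"
  assumes "a < c" "c < b" and f: "continuous_on {a<..<b} f" and g: "continuous_on {a<..<b} g"
    and deriv: "\<And>x. a < x \<Longrightarrow> x < b \<Longrightarrow> x \<noteq> c \<Longrightarrow> (f has_real_derivative g x) (at x)"
  shows "(f has_real_derivative g c) (at c)"
proof -
  define l r where "l = (a + c) / 2" and "r = (c + b) / 2"
  have lr: "a < l" "l < c" "c < r" "r < b" using assms by (auto simp: l_def r_def)
  have *: "integral {l..x} g = f x - f l" if "l \<le> x" "x \<le> r" for x
  proof (rule integral_unique, rule fundamental_theorem_of_calculus_interior_strong[of "{c}"])
    show "continuous_on {l..x} f" by (rule continuous_on_subset[OF f]) (use that lr in auto)
  qed (use that lr deriv in \<open>auto simp flip: has_real_derivative_iff_has_vector_derivative\<close>)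
  have "continuous_on {l..r} g" by (rule continuous_on_subset[OF g]) (use lr in auto)
  then have "((\<lambda>x. integral {l..x} g) has_real_derivative g c) (at c within {l..r})"
    by (rule integral_has_real_derivative) (use lr in auto)
  then have "((\<lambda>x. integral {l..x} g + f l) has_real_derivative g c) (at c)"
    using lr by (auto simp: at_within_Icc_at intro!: derivative_eq_intros)
  moreover have "\<forall>\<^sub>F x in nhds c. integral {l..x} g + f l = f x"
    using eventually_nhds_in_open[of "{l<..<r}" c] lr * by (auto elim!: eventually_mono)
  ultimately show ?thesis by (subst (asm) DERIV_cong_ev[OF refl _ refl]) auto
qed

lemma gen_sin_arch_reflect: "gen_sin_arch p (2 * L_const p - z) = gen_sin_arch p z"
  by (simp add: gen_sin_arch_def min.commute)

lemma gen_cos_arch_reflect: "gen_cos_arch p (2 * L_const p - z) = - gen_cos_arch p z"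
  by (auto simp: gen_cos_arch_def gen_sin_arch_reflect sgn_if)

context
  fixes p :: real
  assumes p: "1 < p"
begin

lemma gen_sin_arch_mem: "z \<in> {0..2 * L_const p} \<Longrightarrow> gen_sin_arch p z \<in> {0..1}"
  unfolding gen_sin_arch_def by (rule gen_sin_mem[OF p]) auto

lemma gen_sin_arch_pos: "0 < z \<Longrightarrow> z < 2 * L_const p \<Longrightarrow> 0 < gen_sin_arch p z"
  unfolding gen_sin_arch_def by (rule gen_sin_pos[OF p]) auto

lemma continuous_on_gen_sin_arch: "continuous_on {0..2 * L_const p} (gen_sin_arch p)"
  unfolding gen_sin_arch_def
  by (rule continuous_on_compose2[OF continuous_on_gen_sin[OF p]]) (auto intro!: continuous_intros)

lemma continuous_on_gen_sin_arch_powr: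
  "0 < e \<Longrightarrow> continuous_on {0..2 * L_const p} (\<lambda>z. gen_sin_arch p z powr e)"
  by (rule continuous_on_powr') (use gen_sin_arch_mem continuous_on_gen_sin_arch in auto)

lemma continuous_on_gen_cos_arch: "continuous_on {0..2 * L_const p} (gen_cos_arch p)"
proof -
  let ?h = "\<lambda>z. sqrt (1 - gen_sin_arch p z powr (p + 1))"
  have h: "continuous_on {0..2 * L_const p} ?h"
    by (intro continuous_intros continuous_on_gen_sin_arch_powr) (use p in auto)
  have "continuous_on ({0..L_const p} \<union> {L_const p..2 * L_const p})
      (\<lambda>z. if z \<le> L_const p then ?h z else - ?h z)"
  proof (rule continuous_on_If)
    show "continuous_on {0..L_const p} ?h" "continuous_on {L_const p..2 * L_const p} (\<lambda>z. - ?h z)"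
      using L_const_pos[OF p] by (auto intro!: continuous_on_minus continuous_on_subset[OF h])
  qed (auto simp: gen_sin_arch_def gen_sin_L[OF p] min_def)
  moreover have "{0..L_const p} \<union> {L_const p..2 * L_const p} = {0..2 * L_const p}"
    using L_const_pos[OF p] by auto
  moreover have "gen_cos_arch p z = (if z \<le> L_const p then ?h z else - ?h z)" for z
    by (auto simp: gen_cos_arch_def sgn_if gen_sin_arch_def gen_sin_L[OF p])
  ultimately show ?thesis by simp
qed

lemma gen_sin_arch_deriv_left:
  assumes "0 < z" "z < L_const p"
  shows "(gen_sin_arch p has_real_derivative gen_cos_arch p z) (at z)"
proof -
  have "\<forall>\<^sub>F x in nhds z. gen_sin_arch p x = gen_sin p x"
    using eventually_nhds_in_open[of "{..<L_const p}" z] assms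
    by (auto elim!: eventually_mono simp: gen_sin_arch_def min_def)
  then show ?thesis
    using gen_sin_deriv[OF p assms] assms
    by (subst DERIV_cong_ev[OF refl]) (auto simp: gen_cos_arch_def gen_sin_arch_def min_def)
qed

text \<open>Differentiating \<open>S' = sqrt (1 - S\<^bsup>p+1\<^esup>)\<close> makes the square root cancel against the factor \<open>S'\<close>;
  what remains, \<open>S'' = - (p + 1) / 2 * S\<^sup>p\<close>, no longer sees which half of the arch it is on.\<close>

lemma gen_cos_arch_deriv_left:
  assumes "0 < z" "z < L_const p"
  shows "(gen_cos_arch p has_real_derivative - ((p + 1) / 2 * gen_sin_arch p z powr p)) (at z)"
proof -
  define s c where "s = gen_sin_arch p z" and "c = sqrt (1 - s powr (p + 1))"
  have s: "0 < s" "s < 1"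
    using gen_sin_arch_pos[of z] gen_sin_less_1[OF p, of z] assms
    by (auto simp: s_def gen_sin_arch_def min_def)
  have q: "s powr (p + 1) < 1" using powr_less_one_unit[of s "p + 1"] s p by simp
  have D: "(gen_sin_arch p has_real_derivative c) (at z)"
    using gen_sin_arch_deriv_left[OF assms] assms by (simp add: gen_cos_arch_def c_def s_def)
  have "((\<lambda>z. gen_sin_arch p z powr (p + 1)) has_real_derivative (p + 1) * s powr p * c) (at z)"
    using DERIV_chain2[OF has_real_derivative_powr[of "gen_sin_arch p z" "p + 1"] D] s
    by (simp add: s_def)
  then have "((\<lambda>z. sqrt (1 - gen_sin_arch p z powr (p + 1))) has_real_derivative
      inverse (sqrt (1 - gen_sin_arch p z powr (p + 1))) / 2 * (0 - (p + 1) * s powr p * c)) (at z)"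
    using q by (intro DERIV_chain2[OF DERIV_real_sqrt] DERIV_diff DERIV_const) (auto simp: s_def)
  also have "inverse (sqrt (1 - gen_sin_arch p z powr (p + 1))) / 2 * (0 - (p + 1) * s powr p * c)
      = - ((p + 1) / 2 * gen_sin_arch p z powr p)"
    using q by (simp add: s_def[symmetric] c_def field_simps)
  finally have "((\<lambda>z. sqrt (1 - gen_sin_arch p z powr (p + 1))) has_real_derivative
      - ((p + 1) / 2 * gen_sin_arch p z powr p)) (at z)" .
  moreover have "\<forall>\<^sub>F x in nhds z. gen_cos_arch p x = sqrt (1 - gen_sin_arch p x powr (p + 1))"
    using eventually_nhds_in_open[of "{..<L_const p}" z] assms
    by (auto elim!: eventually_mono simp: gen_cos_arch_def)
  ultimately show ?thesis by (subst DERIV_cong_ev[OF refl]) auto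
qed

lemma gen_sin_arch_deriv:
  assumes "0 < z" "z < 2 * L_const p"
  shows "(gen_sin_arch p has_real_derivative gen_cos_arch p z) (at z)"
proof -
  have *: "(gen_sin_arch p has_real_derivative gen_cos_arch p z) (at z)"
    if z: "0 < z" "z < 2 * L_const p" "z \<noteq> L_const p" for z
  proof (cases "z < L_const p")
    case False
    have "((\<lambda>x. gen_sin_arch p (2 * L_const p - x)) has_real_derivative
        gen_cos_arch p (2 * L_const p - z) * (0 - 1)) (at z)"
      by (intro DERIV_chain2[OF gen_sin_arch_deriv_left] derivative_intros) (use z False in auto)
    then show ?thesis by (simp add: gen_sin_arch_reflect gen_cos_arch_reflect)
  qed (use gen_sin_arch_deriv_left z in auto)
  show ?thesis
  proof (cases "z = L_const p")
    case True
    show ?thesis unfolding True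
      by (rule DERIV_removable[of 0 _ "2 * L_const p", OF _ _
            continuous_on_subset[OF continuous_on_gen_sin_arch]
            continuous_on_subset[OF continuous_on_gen_cos_arch] *])
         (use L_const_pos[OF p] in auto)
  qed (use * assms in auto)
qed

lemma gen_cos_arch_deriv:
  assumes "0 < z" "z < 2 * L_const p"
  shows "(gen_cos_arch p has_real_derivative - ((p + 1) / 2 * gen_sin_arch p z powr p)) (at z)"
proof -
  have *: "(gen_cos_arch p has_real_derivative - ((p + 1) / 2 * gen_sin_arch p z powr p)) (at z)"
    if z: "0 < z" "z < 2 * L_const p" "z \<noteq> L_const p" for z
  proof (cases "z < L_const p")
    case False
    have "((\<lambda>x. - gen_cos_arch p (2 * L_const p - x)) has_real_derivative
        - (- ((p + 1) / 2 * gen_sin_arch p (2 * L_const p - z) powr p) * (0 - 1))) (at z)"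
      by (intro DERIV_minus DERIV_chain2[OF gen_cos_arch_deriv_left] DERIV_diff DERIV_const DERIV_ident)
         (use z False in auto)
    then show ?thesis by (simp add: gen_sin_arch_reflect gen_cos_arch_reflect)
  qed (use gen_cos_arch_deriv_left z in auto)
  show ?thesis
  proof (cases "z = L_const p")
    case True
    have "continuous_on {0..2 * L_const p} (\<lambda>z. - ((p + 1) / 2 * gen_sin_arch p z powr p))"
      by (intro continuous_on_minus continuous_on_mult_left continuous_on_gen_sin_arch_powr)
         (use p in auto)
    from DERIV_removable[of 0 "L_const p" "2 * L_const p", OF _ _
        continuous_on_subset[OF continuous_on_gen_cos_arch] continuous_on_subset[OF this] *]
    show ?thesis unfolding True using L_const_pos[OF p] by fastforce
  qed (use * assms in auto)
qed

end

section \<open>The boundary value problem on an interval\<close>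

text \<open>The height of the solution on an interval of length \<open>l\<close>; it is the prefactor of the expansion as
  \<open>p\<close> decreases to \<open>1\<close>.\<close>

definition peak :: "real \<Rightarrow> real \<Rightarrow> real" where
  "peak p l = (2 / l) powr (2 / (p - 1)) * ((p + 1) / 2) powr (1 / (p - 1)) *
     L_const p powr (2 / (p - 1))"

definition profile :: "real \<Rightarrow> real \<Rightarrow> real \<Rightarrow> real \<Rightarrow> real" where
  "profile p \<alpha> \<beta> t = peak p (\<beta> - \<alpha>) * gen_sin_arch p (2 * L_const p / (\<beta> - \<alpha>) * (t - \<alpha>))"

definition profile_deriv :: "real \<Rightarrow> real \<Rightarrow> real \<Rightarrow> real \<Rightarrow> real" where
  "profile_deriv p \<alpha> \<beta> t = peak p (\<beta> - \<alpha>) * (2 * L_const p / (\<beta> - \<alpha>)) *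
     gen_cos_arch p (2 * L_const p / (\<beta> - \<alpha>) * (t - \<alpha>))"

lemma peak_pos: "1 < p \<Longrightarrow> 0 < l \<Longrightarrow> 0 < peak p l"
  using L_const_pos[of p] by (auto simp: peak_def intro!: mult_pos_pos)

text \<open>The relation between height and length: with \<open>k = 2 L\<^sub>p / l\<close>, the function
  \<open>M * gen_sin_arch p (k * t)\<close> solves \<open>w'' = - w\<^sup>p\<close> exactly when \<open>M\<^bsup>p-1\<^esup> = k\<^sup>2 (p + 1) / 2\<close>.\<close>

lemma peak_powr:
  assumes "1 < p" "0 < l"
  shows "peak p l powr (p - 1) = (2 * L_const p / l)\<^sup>2 * ((p + 1) / 2)"
proof -
  have e: "2 / (p - 1) * (p - 1) = 2" "1 / (p - 1) * (p - 1) = 1"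
    using assms by (auto simp: field_simps)
  have "peak p l powr (p - 1) = (2 / l) powr 2 * ((p + 1) / 2) powr 1 * L_const p powr 2"
    unfolding peak_def using assms L_const_pos[of p]
    by (simp only: powr_mult powr_powr e)
  then show ?thesis using assms L_const_pos[of p] by (simp add: powr_numeral power_mult_distrib power_divide field_simps)
qed

lemma scaled_mem:
  assumes "1 < p" "\<alpha> < \<beta>" "\<alpha> < t" "t < \<beta>"
  shows "0 < 2 * L_const p / (\<beta> - \<alpha>) * (t - \<alpha>)"
    and "2 * L_const p / (\<beta> - \<alpha>) * (t - \<alpha>) < 2 * L_const p"
proof -
  show "0 < 2 * L_const p / (\<beta> - \<alpha>) * (t - \<alpha>)" using assms L_const_pos[of p] by simp
  have "(t - \<alpha>) / (\<beta> - \<alpha>) < 1" using assms by simp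
  then have "2 * L_const p * ((t - \<alpha>) / (\<beta> - \<alpha>)) < 2 * L_const p * 1"
    using L_const_pos[of p] assms by (intro mult_strict_left_mono) auto
  then show "2 * L_const p / (\<beta> - \<alpha>) * (t - \<alpha>) < 2 * L_const p" by simp
qed

lemma scaled_mem_closed:
  assumes "1 < p" "\<alpha> < \<beta>" "t \<in> {\<alpha>..\<beta>}"
  shows "2 * L_const p / (\<beta> - \<alpha>) * (t - \<alpha>) \<in> {0..2 * L_const p}"
  using scaled_mem[of p \<alpha> \<beta> t] assms L_const_pos[of p]
  by (cases "t = \<alpha> \<or> t = \<beta>") auto

context
  fixes p \<alpha> \<beta> :: real
  assumes p: "1 < p" and ab: "\<alpha> < \<beta>"
begin

lemma profile_left: "profile p \<alpha> \<beta> \<alpha> = 0"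
  and profile_right: "profile p \<alpha> \<beta> \<beta> = 0"
  using ab L_const_pos[OF p] by (auto simp: profile_def gen_sin_arch_def gen_sin_0[OF p])

lemma profile_pos: "\<alpha> < t \<Longrightarrow> t < \<beta> \<Longrightarrow> 0 < profile p \<alpha> \<beta> t"
  unfolding profile_def
  by (intro mult_pos_pos peak_pos gen_sin_arch_pos scaled_mem) (use p ab in auto)

lemma continuous_on_profile: "continuous_on {\<alpha>..\<beta>} (profile p \<alpha> \<beta>)"
  unfolding profile_def
  by (intro continuous_on_mult_left continuous_on_compose2[OF continuous_on_gen_sin_arch[OF p]]
        continuous_intros) (use scaled_mem_closed[OF p ab] in auto)

lemma profile_has_deriv:
  assumes "\<alpha> < t" "t < \<beta>"
  shows "(profile p \<alpha> \<beta> has_real_derivative profile_deriv p \<alpha> \<beta> t) (at t)"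
proof -
  let ?k = "2 * L_const p / (\<beta> - \<alpha>)"
  have "(profile p \<alpha> \<beta> has_real_derivative
      peak p (\<beta> - \<alpha>) * (gen_cos_arch p (?k * (t - \<alpha>)) * (?k * (1 - 0)))) (at t)"
    unfolding profile_def
    by (intro DERIV_cmult DERIV_chain2[OF gen_sin_arch_deriv] DERIV_diff DERIV_ident DERIV_const)
       (use p ab assms scaled_mem in auto)
  then show ?thesis by (simp add: profile_deriv_def mult_ac)
qed

lemma profile_deriv_has_deriv:
  assumes "\<alpha> < t" "t < \<beta>"
  shows "(profile_deriv p \<alpha> \<beta> has_real_derivative - (profile p \<alpha> \<beta> t powr p)) (at t)"
proof -
  define k A s where "k = 2 * L_const p / (\<beta> - \<alpha>)" and "A = peak p (\<beta> - \<alpha>)"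
    and "s = gen_sin_arch p (k * (t - \<alpha>))"
  have A: "0 < A" using peak_pos p ab by (simp add: A_def)
  have s: "0 \<le> s" using gen_sin_arch_pos[OF p scaled_mem[OF p ab assms]] by (simp add: s_def k_def)
  have "(profile_deriv p \<alpha> \<beta> has_real_derivative
      A * k * (- ((p + 1) / 2 * s powr p) * (k * (1 - 0)))) (at t)"
    unfolding profile_deriv_def A_def s_def k_def
    by (intro DERIV_cmult DERIV_chain2[OF gen_cos_arch_deriv] DERIV_diff DERIV_ident DERIV_const)
       (use p ab assms scaled_mem in auto)
  also have "A * k * (- ((p + 1) / 2 * s powr p) * (k * (1 - 0)))
      = - (A * (k\<^sup>2 * ((p + 1) / 2)) * s powr p)"
    by (simp add: power2_eq_square)
  also have "k\<^sup>2 * ((p + 1) / 2) = A powr (p - 1)"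
    using peak_powr[of p "\<beta> - \<alpha>"] p ab by (simp add: k_def A_def)
  also have "A * A powr (p - 1) = A powr p"
    using A by (simp add: powr_mult_base)
  also have "A powr p * s powr p = profile p \<alpha> \<beta> t powr p"
    using A s by (simp add: powr_mult profile_def A_def s_def k_def)
  finally show ?thesis .
qed

end

text \<open>On an increasing branch with maximum \<open>M\<close>, the energy identity is the separable equation
  \<open>w' = \<kappa> M sqrt (1 - (w / M)\<^bsup>p+1\<^esup>)\<close>. Dividing by the square root turns the left-hand side into the
  derivative of \<open>F (w / M)\<close>, which is therefore the constant \<open>\<kappa>\<close>. The branch enters as a function
  with these properties, so that the lemma also covers mirrored decreasing branches.\<close>

lemma time_map:
  fixes w w' :: "real \<Rightarrow> real"
  assumes p: "1 < p" and M: "0 < M" and cont: "continuous_on {\<alpha>..m} w" and "w \<alpha> = 0"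
    and bnd: "\<And>t. t \<in> {\<alpha>..m} \<Longrightarrow> 0 \<le> w t \<and> w t \<le> M"
    and inn: "\<And>t. \<alpha> < t \<Longrightarrow> t < m \<Longrightarrow> 0 < w t \<and> w t < M \<and> 0 < w' t"
    and deriv: "\<And>t. \<alpha> < t \<Longrightarrow> t < m \<Longrightarrow> (w has_real_derivative w' t) (at t)"
    and energy: "\<And>t. \<alpha> < t \<Longrightarrow> t < m \<Longrightarrow>
      (w' t)\<^sup>2 = 2 / (p + 1) * (M powr (p + 1) - w t powr (p + 1))"
    and t: "t \<in> {\<alpha>..m}"
  shows "gen_arcsin p (w t / M) = sqrt (2 / (p + 1) * M powr (p - 1)) * (t - \<alpha>)"
proof (cases "t = \<alpha>")
  case False
  define \<kappa> where "\<kappa> = sqrt (2 / (p + 1) * M powr (p - 1))"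
  define g where "g = (\<lambda>t. gen_arcsin p (w t / M) - \<kappa> * t)"
  have \<kappa>2: "\<kappa>\<^sup>2 = 2 / (p + 1) * M powr (p - 1)" and \<kappa>: "0 < \<kappa>"
    using p M by (auto simp: \<kappa>_def)
  have "g t = g \<alpha>"
  proof (rule DERIV_isconst_end[where f = g])
    have "continuous_on {\<alpha>..t} w" by (rule continuous_on_subset[OF cont]) (use t in auto)
    then have "continuous_on {\<alpha>..t} (\<lambda>t. gen_arcsin p (w t / M))"
      by (intro continuous_on_compose2[OF continuous_on_gen_arcsin[OF p]] continuous_intros)
         (use bnd t M in auto)
    then show "continuous_on {\<alpha>..t} g" unfolding g_def by (intro continuous_intros)
  next
    fix x assume x: "\<alpha> < x" "x < t"
    then have x': "\<alpha> < x" "x < m" using t by auto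
    define y where "y = w x / M"
    have y: "0 < y" "y < 1" using inn[OF x'] M by (auto simp: y_def)
    have q: "y powr (p + 1) < 1" using powr_less_one_unit[of y "p + 1"] y p by simp
    have "w' x = \<kappa> * M * sqrt (1 - y powr (p + 1))"
    proof (rule power2_eq_imp_eq)
      have "w x powr (p + 1) = M powr (p + 1) * y powr (p + 1)"
        using M y by (simp add: y_def flip: powr_mult)
      then have "(w' x)\<^sup>2 = 2 / (p + 1) * (M powr (p - 1) * M powr 2) * (1 - y powr (p + 1))"
        using energy[OF x'] by (simp add: algebra_simps diff_divide_distrib flip: powr_add)
      also have "\<dots> = (\<kappa> * M * sqrt (1 - y powr (p + 1)))\<^sup>2"
        using M q by (simp add: power_mult_distrib \<kappa>2)
      finally show "(w' x)\<^sup>2 = (\<kappa> * M * sqrt (1 - y powr (p + 1)))\<^sup>2" .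
    qed (use inn[OF x'] \<kappa> M q in auto)
    moreover have "(gen_arcsin p has_real_derivative 1 / sqrt (1 - y powr (p + 1))) (at (w x / M))"
      using gen_arcsin_deriv[OF p y] by (simp add: y_def)
    from DERIV_chain2[OF this DERIV_cdivide[OF deriv[OF x'], of M]]
    have "(g has_real_derivative 1 / sqrt (1 - y powr (p + 1)) * (w' x / M) - \<kappa> * 1) (at x)"
      unfolding g_def by (intro DERIV_diff DERIV_cmult DERIV_ident)
    ultimately show "(g has_real_derivative 0) (at x)" using M q by simp
  qed (use t False in auto)
  then show ?thesis using \<open>w \<alpha> = 0\<close> by (simp add: g_def \<kappa>_def algebra_simps)
qed (use \<open>w \<alpha> = 0\<close> in simp)

text \<open>The energy determines \<open>w\<close> completely: \<open>time_map\<close> is used on the left of the maximum point, and on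
  the right after the reflection \<open>t \<mapsto> - t\<close>; the two branches must meet at the maximum point, and
  this fixes its position and the value of \<open>M\<close>.\<close>

lemma profile_unique:
  fixes w w' :: "real \<Rightarrow> real"
  assumes p: "1 < p" and ab: "\<alpha> < \<beta>" and cont: "continuous_on {\<alpha>..\<beta>} w"
    and zero: "w \<alpha> = 0" "w \<beta> = 0"
    and pos: "\<And>t. \<alpha> < t \<Longrightarrow> t < \<beta> \<Longrightarrow> 0 < w t"
    and deriv: "\<And>t. \<alpha> < t \<Longrightarrow> t < \<beta> \<Longrightarrow> (w has_real_derivative w' t) (at t)"
    and deriv': "\<And>t. \<alpha> < t \<Longrightarrow> t < \<beta> \<Longrightarrow> (w' has_real_derivative - (w t powr p)) (at t)"
    and t: "t \<in> {\<alpha>..\<beta>}"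
  shows "w t = profile p \<alpha> \<beta> t"
proof -
  obtain m where m: "m \<in> {\<alpha>..\<beta>}" and max: "\<And>s. s \<in> {\<alpha>..\<beta>} \<Longrightarrow> w s \<le> w m"
    using continuous_attains_sup[OF compact_Icc _ cont] ab by auto
  define M where "M = w m"
  have "0 < w ((\<alpha> + \<beta>) / 2)" using ab by (intro pos) auto
  also have "\<dots> \<le> M" unfolding M_def using ab by (intro max) auto
  finally have M: "0 < M" .
  then have m': "\<alpha> < m" "m < \<beta>" using m zero by (auto simp: M_def less_le)
  have crit: "w' m = 0"
  proof (rule DERIV_local_max[OF deriv[OF m']])
    show "0 < min (m - \<alpha>) (\<beta> - m)" using m' by simp
    show "\<forall>y. \<bar>m - y\<bar> < min (m - \<alpha>) (\<beta> - m) \<longrightarrow> w y \<le> w m" by (auto intro!: max)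
  qed
  have decr: "w' s > w' t" if "\<alpha> < s" "s < t" "t < \<beta>" for s t
    using that(2)
  proof (rule DERIV_neg_imp_decreasing)
    fix x assume "s \<le> x" "x \<le> t"
    then show "\<exists>y. (w' has_real_derivative y) (at x) \<and> y < 0"
      using that deriv'[of x] pos[of x] by (intro exI[of _ "- (w x powr p)"]) auto
  qed
  have energy: "(w' s)\<^sup>2 = 2 / (p + 1) * (M powr (p + 1) - w s powr (p + 1))"
    if s: "\<alpha> < s" "s < \<beta>" for s
  proof -
    define E where "E = (\<lambda>t. (w' t)\<^sup>2 + 2 / (p + 1) * w t powr (p + 1))"
    have "(E has_real_derivative 0) (at x)" if x: "\<alpha> < x" "x < \<beta>" for x
    proof -
      have "((\<lambda>t. w t powr (p + 1)) has_real_derivative (p + 1) * w x powr p * w' x) (at x)"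
        using DERIV_chain2[OF has_real_derivative_powr[OF pos[OF x], of "p + 1"] deriv[OF x]] by simp
      then have "(E has_real_derivative
          of_nat 2 * (- (w x powr p) * w' x ^ (2 - Suc 0)) + 2 / (p + 1) * ((p + 1) * w x powr p * w' x)) (at x)"
        unfolding E_def by (intro DERIV_add DERIV_cmult DERIV_power deriv' x)
      then show ?thesis using p by simp
    qed
    then have "\<exists>c. \<forall>x\<in>{\<alpha><..<\<beta>}. E x = c"
      by (intro has_field_derivative_zero_constant) (auto intro: has_field_derivative_at_within)
    then have "E s = E m" using s m' by auto
    then show ?thesis using crit by (simp add: E_def M_def algebra_simps)
  qed
  \<comment> \<open>\<open>w'\<close> is strictly decreasing and vanishes at \<open>m\<close>, which fixes its sign on both sides.\<close>
  define \<kappa> where "\<kappa> = sqrt (2 / (p + 1) * M powr (p - 1))"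
  have left_pos: "0 < w' s" if "\<alpha> < s" "s < m" for s
    using decr[of s m] crit that m' by simp
  have right_neg: "w' s < 0" if "m < s" "s < \<beta>" for s
    using decr[of m s] crit that m' by simp
  have nonneg: "0 \<le> w s" if "s \<in> {\<alpha>..\<beta>}" for s
    using pos[of s] zero that by (cases "s = \<alpha> \<or> s = \<beta>") (auto simp: less_le)
  have left: "gen_arcsin p (w s / M) = \<kappa> * (s - \<alpha>)" if s: "s \<in> {\<alpha>..m}" for s
    unfolding \<kappa>_def
  proof (rule time_map[where w = w and w' = w' and m = m, OF p M _ zero(1)])
    show "continuous_on {\<alpha>..m} w" by (rule continuous_on_subset[OF cont]) (use m in auto)
    fix x assume x: "\<alpha> < x" "x < m"
    have "w x < w m"
    proof (rule DERIV_pos_imp_increasing_open[OF x(2)])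
      show "continuous_on {x..m} w" by (rule continuous_on_subset[OF cont]) (use m x in auto)
      show "\<exists>y. (w has_real_derivative y) (at z) \<and> 0 < y" if "x < z" "z < m" for z
        by (intro exI[of _ "w' z"] conjI deriv left_pos) (use that x m' in auto)
    qed
    then show "0 < w x \<and> w x < M \<and> 0 < w' x" using pos left_pos x m' by (simp add: M_def)
  qed (use s m m' max nonneg deriv energy in \<open>auto simp: M_def\<close>)
  have right: "gen_arcsin p (w s / M) = \<kappa> * (\<beta> - s)" if s: "s \<in> {m..\<beta>}" for s
  proof -
    have "gen_arcsin p (w (- (- s)) / M) = \<kappa> * (- s - (- \<beta>))"
      unfolding \<kappa>_def
    proof (rule time_map[OF p M, of "- \<beta>" "- m" "\<lambda>t. w (- t)" "\<lambda>t. - w' (- t)"])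
      show "continuous_on {- \<beta>..- m} (\<lambda>t. w (- t))"
        by (rule continuous_on_compose2[OF cont]) (use m in \<open>auto intro!: continuous_intros\<close>)
      fix x assume x: "- \<beta> < x" "x < - m"
      have "w (- x) < w m"
      proof (rule DERIV_neg_imp_decreasing_open[where f = w])
        show "continuous_on {m..- x} w" by (rule continuous_on_subset[OF cont]) (use m x in auto)
        show "\<exists>y. (w has_real_derivative y) (at z) \<and> y < 0" if "m < z" "z < - x" for z
          by (intro exI[of _ "w' z"] conjI deriv right_neg) (use that x m' in auto)
      qed (use x in auto)
      then show "0 < w (- x) \<and> w (- x) < M \<and> 0 < - w' (- x)"
        using pos right_neg x m' by (simp add: M_def)
      have "((\<lambda>t. w (- t)) has_real_derivative w' (- x) * - 1) (at x)"
        by (intro DERIV_chain2[OF deriv] DERIV_minus DERIV_ident) (use x m' in auto)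
      then show "((\<lambda>t. w (- t)) has_real_derivative - w' (- x)) (at x)" by simp
    qed (use s m m' zero max nonneg energy in \<open>auto simp: M_def\<close>)
    then show ?thesis by simp
  qed
  \<comment> \<open>At the maximum point both branches take the value \<open>F 1 = L\<^sub>p\<close>; so it is the midpoint.\<close>
  have "\<kappa> * (m - \<alpha>) = L_const p" "\<kappa> * (\<beta> - m) = L_const p"
    using left[of m] right[of m] m M by (auto simp: M_def)
  then have sum: "\<kappa> * (\<beta> - \<alpha>) = 2 * L_const p" by (simp add: algebra_simps)
  then have \<kappa>: "\<kappa> = 2 * L_const p / (\<beta> - \<alpha>)" using ab by (simp add: field_simps)
  have "\<kappa>\<^sup>2 = 2 / (p + 1) * M powr (p - 1)" using p M by (simp add: \<kappa>_def)
  then have "M powr (p - 1) = \<kappa>\<^sup>2 * ((p + 1) / 2)" using p by (simp add: field_simps)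
  also have "\<dots> = peak p (\<beta> - \<alpha>) powr (p - 1)"
    using peak_powr[of p "\<beta> - \<alpha>"] p ab by (simp add: \<kappa>)
  finally have "(M powr (p - 1)) powr (1 / (p - 1)) = (peak p (\<beta> - \<alpha>) powr (p - 1)) powr (1 / (p - 1))"
    by simp
  then have MP: "M = peak p (\<beta> - \<alpha>)"
    using M p peak_pos[of p "\<beta> - \<alpha>"] ab by (simp add: powr_powr)
  have \<kappa>0: "0 < \<kappa>" using p M by (simp add: \<kappa>_def)
  have "gen_arcsin p (w t / M) = min (\<kappa> * (t - \<alpha>)) (2 * L_const p - \<kappa> * (t - \<alpha>))"
  proof (cases "t \<le> m")
    case True
    then have "\<kappa> * (t - \<alpha>) \<le> \<kappa> * (m - \<alpha>)" using \<kappa>0 by simp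
    then have "\<kappa> * (t - \<alpha>) \<le> L_const p" using \<open>\<kappa> * (m - \<alpha>) = L_const p\<close> by simp
    then show ?thesis using left[of t] True t by simp
  next
    case False
    have e: "\<kappa> * (\<beta> - t) = 2 * L_const p - \<kappa> * (t - \<alpha>)" using sum by (simp add: algebra_simps)
    have "\<kappa> * (\<beta> - t) \<le> \<kappa> * (\<beta> - m)" using \<kappa>0 False by simp
    then have "\<kappa> * (\<beta> - t) \<le> L_const p" using \<open>\<kappa> * (\<beta> - m) = L_const p\<close> by simp
    then show ?thesis using right[of t] False t e by simp
  qed
  moreover have "gen_sin p (gen_arcsin p (w t / M)) = w t / M"
    using max[of t] nonneg[of t] t M by (intro gen_sin_gen_arcsin p) (auto simp: M_def)
  ultimately have "w t / M = gen_sin_arch p (\<kappa> * (t - \<alpha>))" by (simp add: gen_sin_arch_def)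
  then show ?thesis using M by (simp add: profile_def MP \<kappa> field_simps)
qed

section \<open>Radial functions in logarithmic polar coordinates\<close>

text \<open>Along a coordinate line, \<open>ln |x|\<close> is half the logarithm of a quadratic polynomial.\<close>

lemma ln_norm_partial:
  fixes x :: "real^'n::finite"
  assumes "x \<noteq> 0"
  shows "((\<lambda>t. ln (norm (x + t *\<^sub>R axis i 1))) has_real_derivative x $ i / (norm x)\<^sup>2) (at 0)"
proof -
  have xx: "0 < x \<bullet> x" using assms by simp
  have eq: "ln (norm (x + t *\<^sub>R axis i 1)) = ln (x \<bullet> x + t * (2 * x $ i) + t\<^sup>2) / 2" for t
  proof -
    have "(x + t *\<^sub>R axis i 1) \<bullet> (x + t *\<^sub>R axis i 1) = x \<bullet> x + t * (2 * x $ i) + t\<^sup>2"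
      by (simp add: inner_add_left inner_add_right inner_axis inner_commute[of "axis i 1"]
          power2_eq_square distrib_left)
    moreover have "ln (norm y) = ln (y \<bullet> y) / 2" for y :: "real^'n"
      by (cases "y = 0") (simp_all add: norm_eq_sqrt_inner ln_sqrt)
    ultimately show ?thesis by simp
  qed
  have "((\<lambda>t. ln (x \<bullet> x + t * (2 * x $ i) + t\<^sup>2) / 2) has_real_derivative
      inverse (x \<bullet> x + 0 * (2 * x $ i) + 0\<^sup>2) * (2 * x $ i) / 2) (at 0)"
    by (intro DERIV_cdivide DERIV_chain2[OF DERIV_ln])
       (use xx in \<open>auto intro!: derivative_eq_intros\<close>)
  also have "inverse (x \<bullet> x + 0 * (2 * x $ i) + 0\<^sup>2) * (2 * x $ i) / 2 = x $ i / (norm x)\<^sup>2"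
    using xx by (simp add: power2_norm_eq_inner field_simps)
  finally show ?thesis by (simp only: eq)
qed

lemma partial_deriv_eqI:
  assumes "((\<lambda>t. u (x + t *\<^sub>R axis i 1)) has_real_derivative D) (at 0)"
  shows "partial_deriv i u x = D" and "has_partial_deriv_at i u x"
  using assms by (auto simp: partial_deriv_def has_partial_deriv_at_def field_differentiable_def
      intro: DERIV_imp_deriv)

text \<open>Partial derivatives are local: formulas for \<open>u\<close> or for \<open>partial_deriv i u\<close> are known only inside the
  annulus, which suffices because it is open.\<close>

lemma has_deriv_line_cong:
  fixes u v :: "real^'n::finite \<Rightarrow> real"
  assumes "open A" "x \<in> A" "\<And>y. y \<in> A \<Longrightarrow> u y = v y"
    and "((\<lambda>t. v (x + t *\<^sub>R axis i 1)) has_real_derivative D) (at 0)"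
  shows "((\<lambda>t. u (x + t *\<^sub>R axis i 1)) has_real_derivative D) (at 0)"
proof -
  have "((\<lambda>t. x + t *\<^sub>R axis i 1) \<longlongrightarrow> x + 0 *\<^sub>R axis i (1::real)) (nhds (0::real))"
    by (intro tendsto_intros filterlim_ident)
  then have "\<forall>\<^sub>F t in nhds 0. x + t *\<^sub>R axis i 1 \<in> A"
    using assms(1,2) by (auto intro: topological_tendstoD)
  then have "\<forall>\<^sub>F t in nhds 0. u (x + t *\<^sub>R axis i 1) = v (x + t *\<^sub>R axis i 1)"
    by eventually_elim (rule assms(3))
  then show ?thesis using assms(4) by (subst DERIV_cong_ev[OF refl _ refl])
qed

lemma open_annulus: "open (annulus a b)"
  unfolding annulus_def by (intro open_Collect_conj open_Collect_less continuous_intros)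

context
  fixes a b :: real and w w' w'' :: "real \<Rightarrow> real" and u :: "real^2 \<Rightarrow> real"
  assumes a: "0 < a"
    and u: "\<And>x. x \<in> annulus a b \<Longrightarrow> u x = w (ln (norm x))"
    and w: "\<And>t. ln a < t \<Longrightarrow> t < ln b \<Longrightarrow> (w has_real_derivative w' t) (at t)"
    and w': "\<And>t. ln a < t \<Longrightarrow> t < ln b \<Longrightarrow> (w' has_real_derivative w'' t) (at t)"
begin

lemma ln_norm_annulus:
  assumes "x \<in> annulus a b"
  shows "x \<noteq> 0" "ln a < ln (norm x)" "ln (norm x) < ln b"
proof -
  show "x \<noteq> 0" "ln a < ln (norm x)" "ln (norm x) < ln b"
    using a assms by (auto simp: annulus_def intro!: ln_strict_mono)
qed

lemma radial_partial:
  assumes x: "x \<in> annulus a b"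
  shows "((\<lambda>t. u (x + t *\<^sub>R axis i 1)) has_real_derivative
    w' (ln (norm x)) * (x $ i / (norm x)\<^sup>2)) (at 0)"
proof (rule has_deriv_line_cong[OF open_annulus x u])
  have "(w has_real_derivative w' (ln (norm x))) (at (ln (norm (x + 0 *\<^sub>R axis i 1))))"
    using w ln_norm_annulus[OF x] by simp
  from DERIV_chain2[OF this ln_norm_partial[OF ln_norm_annulus(1)[OF x]]]
  show "((\<lambda>t. w (ln (norm (x + t *\<^sub>R axis i 1)))) has_real_derivative
    w' (ln (norm x)) * (x $ i / (norm x)\<^sup>2)) (at 0)" .
qed

text \<open>Writing \<open>|x|\<^bsup>-2\<^esup>\<close> as \<open>exp (- 2 ln |x|)\<close> reduces every differentiation to that of \<open>ln |x|\<close>.\<close>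

lemma radial_partial_partial:
  assumes x: "x \<in> annulus a b"
  shows "((\<lambda>t. partial_deriv i u (x + t *\<^sub>R axis j 1)) has_real_derivative
    (w'' (ln (norm x)) - 2 * w' (ln (norm x))) * (x $ i * x $ j) / (norm x) ^ 4
     + w' (ln (norm x)) * (if i = j then 1 else 0) / (norm x)\<^sup>2) (at 0)"
proof (rule has_deriv_line_cong[OF open_annulus x])
  fix y assume "y \<in> annulus a b"
  from partial_deriv_eqI(1)[OF radial_partial[OF this]] ln_norm_annulus[OF this]
  show "partial_deriv i u y = w' (ln (norm y)) * (y $ i * exp (- 2 * ln (norm y)))"
    by (simp add: exp_minus exp_double divide_inverse)
next
  have nz: "x \<noteq> 0" using ln_norm_annulus[OF x] by simp
  have L: "((\<lambda>t. ln (norm (x + t *\<^sub>R axis j 1))) has_real_derivative x $ j / (norm x)\<^sup>2) (at 0)"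
    by (rule ln_norm_partial[OF nz])
  have "(w' has_real_derivative w'' (ln (norm x))) (at (ln (norm (x + 0 *\<^sub>R axis j 1))))"
    using w' ln_norm_annulus[OF x] by simp
  note 1 = DERIV_chain2[OF this L]
  have 2: "((\<lambda>t. (x + t *\<^sub>R axis j 1) $ i) has_real_derivative (if i = j then 1 else 0)) (at 0)"
    by (auto simp: axis_def intro!: derivative_eq_intros)
  have 3: "((\<lambda>t. exp (- 2 * ln (norm (x + t *\<^sub>R axis j 1)))) has_real_derivative
      exp (- 2 * ln (norm (x + 0 *\<^sub>R axis j 1))) * (- 2 * (x $ j / (norm x)\<^sup>2))) (at 0)"
    by (intro DERIV_chain2[OF DERIV_exp] DERIV_cmult L)
  define k where "k = 1 / (norm x)\<^sup>2"
  have e: "exp (- 2 * ln (norm x)) = k"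
    using nz by (simp add: k_def exp_minus exp_double divide_inverse)
  have k2: "z / (norm x)\<^sup>2 = z * k" and k4: "z / (norm x) ^ 4 = z * k * k" for z
    by (simp_all add: k_def power4_eq_xxxx power2_eq_square)
  show "((\<lambda>t. w' (ln (norm (x + t *\<^sub>R axis j 1))) * ((x + t *\<^sub>R axis j 1) $ i *
        exp (- 2 * ln (norm (x + t *\<^sub>R axis j 1))))) has_real_derivative
    (w'' (ln (norm x)) - 2 * w' (ln (norm x))) * (x $ i * x $ j) / (norm x) ^ 4
     + w' (ln (norm x)) * (if i = j then 1 else 0) / (norm x)\<^sup>2) (at 0)"
    by (rule DERIV_cong[OF DERIV_mult[OF 1 DERIV_mult[OF 2 3]]])
       (simp only: scaleR_zero_left add_0_right e k2 k4, simp add: algebra_simps)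
qed

text \<open>In dimension two the terms with \<open>w'\<close> cancel: the trace of \<open>\<delta>\<^sub>i\<^sub>j / |x|\<^sup>2 - 2 x\<^sub>i x\<^sub>j / |x|\<^sup>4\<close> is
  \<open>(2 - 2) / |x|\<^sup>2\<close>.\<close>

lemma radial_laplacian:
  assumes x: "x \<in> annulus a b"
  shows "laplacian u x = w'' (ln (norm x)) / (norm x)\<^sup>2"
proof -
  have nz: "norm x \<noteq> 0" using ln_norm_annulus[OF x] by simp
  have n2: "(norm x)\<^sup>2 = x $ 1 * x $ 1 + x $ 2 * x $ 2"
    by (simp add: power2_norm_eq_inner inner_vec_def sum_2)
  have n4: "(norm x) ^ 4 = (norm x)\<^sup>2 * (norm x)\<^sup>2" by simp
  have "laplacian u x = (w'' (ln (norm x)) - 2 * w' (ln (norm x))) * (x $ 1 * x $ 1 + x $ 2 * x $ 2) /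
      (norm x) ^ 4 + 2 * w' (ln (norm x)) / (norm x)\<^sup>2"
    unfolding laplacian_def sum_2 partial_deriv_eqI(1)[OF radial_partial_partial[OF x]]
    by (simp add: algebra_simps add_divide_distrib diff_divide_distrib)
  also have "\<dots> = w'' (ln (norm x)) / (norm x)\<^sup>2"
    unfolding n2[symmetric] n4 using nz by (simp add: field_simps)
  finally show ?thesis .
qed

lemma radial_C2:
  assumes w''_cont: "continuous_on {ln a<..<ln b} w''"
  shows "C2_on (annulus a b) u"
proof -
  have ln_cont: "continuous_on (annulus a b) (\<lambda>x. ln (norm x))"
    by (intro continuous_intros) (use ln_norm_annulus in auto)
  have comp: "continuous_on (annulus a b) (\<lambda>x. g (ln (norm x)))"
    if "continuous_on {ln a<..<ln b} g" for g :: "real \<Rightarrow> real"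
    by (rule continuous_on_compose2[OF that ln_cont]) (use ln_norm_annulus in auto)
  have c0: "continuous_on (annulus a b) (\<lambda>x. w (ln (norm x)))"
    by (rule comp, rule DERIV_continuous_on[of _ _ w']) (auto intro: has_field_derivative_at_within w)
  have c1: "continuous_on (annulus a b) (\<lambda>x. w' (ln (norm x)))"
    by (rule comp, rule DERIV_continuous_on[of _ _ w'']) (auto intro: has_field_derivative_at_within w')
  have c2: "continuous_on (annulus a b) (\<lambda>x. w'' (ln (norm x)))"
    by (rule comp[OF w''_cont])
  have coord: "continuous_on (annulus a b) (\<lambda>x. x $ i)" for i :: 2
    by (intro continuous_intros)
  have "continuous_on (annulus a b) (partial_deriv i u)" for i
  proof -
    have "continuous_on (annulus a b) (\<lambda>x. w' (ln (norm x)) * (x $ i / (norm x)\<^sup>2))"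
      by (intro continuous_intros c1 coord) (use ln_norm_annulus in auto)
    then show ?thesis
      by (rule continuous_on_eq) (simp add: partial_deriv_eqI(1)[OF radial_partial])
  qed
  moreover have "continuous_on (annulus a b) (partial_deriv j (partial_deriv i u))" for i j
  proof -
    have "continuous_on (annulus a b) (\<lambda>x.
      (w'' (ln (norm x)) - 2 * w' (ln (norm x))) * (x $ i * x $ j) / (norm x) ^ 4
       + w' (ln (norm x)) * (if i = j then 1 else 0) / (norm x)\<^sup>2)"
      by (intro continuous_intros c1 c2 coord) (use ln_norm_annulus in auto)
    then show ?thesis
      by (rule continuous_on_eq) (simp add: partial_deriv_eqI(1)[OF radial_partial_partial])
  qed
  moreover have "continuous_on (annulus a b) u"
    by (rule continuous_on_eq[OF c0]) (simp add: u)
  ultimately show ?thesis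
    unfolding C2_on_def
    using partial_deriv_eqI(2)[OF radial_partial] partial_deriv_eqI(2)[OF radial_partial_partial]
    by blast
qed

end

section \<open>Radial solutions on the annulus\<close>

lemma closure_annulus:
  assumes "0 < a" "a < b"
  shows "closure (annulus a b) = {x. a \<le> norm x \<and> norm x \<le> b}"
proof
  have "closed {x :: real^2. a \<le> norm x \<and> norm x \<le> b}"
    by (intro closed_Collect_conj closed_Collect_le continuous_intros)
  then show "closure (annulus a b) \<subseteq> {x. a \<le> norm x \<and> norm x \<le> b}"
    by (rule closure_minimal[rotated]) (auto simp: annulus_def)
  show "{x. a \<le> norm x \<and> norm x \<le> b} \<subseteq> closure (annulus a b)"
  proof
    fix x :: "real^2" assume "x \<in> {x. a \<le> norm x \<and> norm x \<le> b}"
    then have x: "norm x \<in> closure {a<..<b}" "0 < norm x" using assms by auto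
    have "(\<lambda>s. (s / norm x) *\<^sub>R x) ` closure {a<..<b} \<subseteq> closure (annulus a b)"
    proof (rule image_closure_subset)
      show "(\<lambda>s. (s / norm x) *\<^sub>R x) ` {a<..<b} \<subseteq> closure (annulus a b)"
      proof (rule image_subsetI)
        fix s assume "s \<in> {a<..<b}"
        then have "(s / norm x) *\<^sub>R x \<in> annulus a b" using assms x by (auto simp: annulus_def)
        then show "(s / norm x) *\<^sub>R x \<in> closure (annulus a b)" using closure_subset by blast
      qed
    qed (use x in \<open>auto intro!: continuous_intros\<close>)
    moreover have "(\<lambda>s. (s / norm x) *\<^sub>R x) (norm x) = x" using x by simp
    ultimately show "x \<in> closure (annulus a b)" using x(1) by (metis image_subset_iff)
  qed
qed

lemma frontier_annulus:
  assumes "0 < a" "a < b"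
  shows "frontier (annulus a b) = {x. norm x = a \<or> norm x = b}"
  unfolding frontier_def closure_annulus[OF assms] interior_open[OF open_annulus]
  using assms by (auto simp: annulus_def)

lemma profile_is_radial_solution:
  assumes a: "0 < a" and ab: "a < b" and p: "1 < p"
  shows "radial_solution a b p (\<lambda>x. profile p (ln a) (ln b) (ln (norm x)))"
proof -
  let ?w = "profile p (ln a) (ln b)" and ?u = "\<lambda>x :: real^2. profile p (ln a) (ln b) (ln (norm x))"
  let ?w'' = "\<lambda>t. - (?w t powr p)"
  have lab: "ln a < ln b" using a ab by simp
  note d1 = profile_has_deriv[OF p lab] and d2 = profile_deriv_has_deriv[OF p lab]
  have cw: "continuous_on {ln a..ln b} ?w" by (rule continuous_on_profile[OF p lab])
  have "continuous_on {ln a<..<ln b} ?w" by (rule continuous_on_subset[OF cw]) auto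
  then have "continuous_on {ln a<..<ln b} ?w''"
    by (intro continuous_on_minus continuous_on_powr' continuous_on_const)
       (use profile_pos[OF p lab] p in \<open>auto simp: less_imp_le\<close>)
  with radial_C2[where b = b and w = ?w and w'' = ?w'' and u = ?u, OF a refl d1 d2]
  have C2: "C2_on (annulus a b) ?u" by blast
  have lap: "- laplacian ?u x = ?u x powr p / (norm x)\<^sup>2" if "x \<in> annulus a b" for x
    using radial_laplacian[where b = b and w = ?w and w'' = ?w'' and u = ?u, OF a refl d1 d2 that] by simp
  have cont: "continuous_on (closure (annulus a b)) ?u"
    unfolding closure_annulus[OF a ab]
    by (rule continuous_on_compose2[OF cw]) (use a in \<open>auto intro!: continuous_intros ln_mono\<close>)
  have pos: "0 < ?u x" if "x \<in> annulus a b" for x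
    using that a by (intro profile_pos[OF p lab]) (auto simp: annulus_def intro!: ln_strict_mono)
  have zero: "?u x = 0" if "x \<in> frontier (annulus a b)" for x
    using that profile_left[OF p lab] profile_right[OF p lab] by (auto simp: frontier_annulus[OF a ab])
  show ?thesis
    unfolding radial_solution_def classical_solution_def radially_symmetric_on_def
    using C2 lap cont pos zero by auto
qed

text \<open>Restricting \<open>v\<close> to the ray through the first unit vector gives \<open>w t = v (exp t, 0)\<close>. The partial
  derivatives along that ray alone make \<open>w\<close> twice differentiable; by symmetry \<open>v x = w (ln |x|)\<close>
  everywhere, so the full Laplacian is again \<open>w'' / |x|\<^sup>2\<close> and \<open>profile_unique\<close> applies.\<close>

lemma radial_solution_is_profile:
  assumes a: "0 < a" and ab: "a < b" and p: "1 < p" and v: "radial_solution a b p v"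
    and x: "x \<in> closure (annulus a b)"
  shows "v x = profile p (ln a) (ln b) (ln (norm x))"
proof -
  define e :: "real^2" where "e = axis 1 1"
  have ne: "norm e = 1" by (simp add: e_def)
  have ray: "s *\<^sub>R e \<in> annulus a b" if "a < s" "s < b" for s
    using that a by (auto simp: annulus_def ne)
  have C2: "C2_on (annulus a b) v" and cont: "continuous_on (closure (annulus a b)) v"
    and pde: "\<And>x. x \<in> annulus a b \<Longrightarrow> - laplacian v x = v x powr p / (norm x)\<^sup>2"
    and pos: "\<And>x. x \<in> annulus a b \<Longrightarrow> v x > 0"
    and zero: "\<And>x. x \<in> frontier (annulus a b) \<Longrightarrow> v x = 0"
    and sym: "\<And>x y. x \<in> closure (annulus a b) \<Longrightarrow> y \<in> closure (annulus a b) \<Longrightarrow>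
      norm x = norm y \<Longrightarrow> v x = v y"
    using v unfolding radial_solution_def classical_solution_def radially_symmetric_on_def
    by blast+
  define g1 g2 where "g1 = (\<lambda>s. partial_deriv 1 v (s *\<^sub>R e))"
    and "g2 = (\<lambda>s. partial_deriv 1 (partial_deriv 1 v) (s *\<^sub>R e))"
  have along: "((\<lambda>s. f (s *\<^sub>R e)) has_real_derivative partial_deriv 1 f (s *\<^sub>R e)) (at s)"
    if "has_partial_deriv_at 1 f (s *\<^sub>R e)" for f s
  proof -
    have "((\<lambda>t. f (s *\<^sub>R e + t *\<^sub>R e)) has_real_derivative partial_deriv 1 f (s *\<^sub>R e)) (at 0)"
      using that unfolding has_partial_deriv_at_def partial_deriv_def e_def
      by (simp add: DERIV_deriv_iff_field_differentiable)
    then show ?thesis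
      using DERIV_shift[of "\<lambda>s. f (s *\<^sub>R e)" _ 0 s] by (simp add: scaleR_add_left add.commute)
  qed
  have dv: "((\<lambda>s. v (s *\<^sub>R e)) has_real_derivative g1 s) (at s)"
    and dg1: "(g1 has_real_derivative g2 s) (at s)" if "a < s" "s < b" for s
  proof -
    have "has_partial_deriv_at 1 v (s *\<^sub>R e)" "has_partial_deriv_at 1 (partial_deriv 1 v) (s *\<^sub>R e)"
      using C2 ray[OF that] unfolding C2_on_def by blast+
    then show "((\<lambda>s. v (s *\<^sub>R e)) has_real_derivative g1 s) (at s)"
      and "(g1 has_real_derivative g2 s) (at s)"
      unfolding g1_def g2_def by (blast intro: along)+
  qed
  define w w' w'' where "w = (\<lambda>t. v (exp t *\<^sub>R e))" and "w' = (\<lambda>t. g1 (exp t) * exp t)"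
    and "w'' = (\<lambda>t. g2 (exp t) * exp t * exp t + exp t * g1 (exp t))"
  have exp_mem: "a < exp t" "exp t < b" if "ln a < t" "t < ln b" for t
    using that a ab by (metis exp_less_mono exp_ln order.strict_trans)+
  have dw: "(w has_real_derivative w' t) (at t)" if "ln a < t" "t < ln b" for t
    unfolding w_def w'_def by (rule DERIV_chain2[OF dv DERIV_exp]) (use exp_mem[OF that] in auto)
  have dw': "(w' has_real_derivative w'' t) (at t)" if "ln a < t" "t < ln b" for t
    unfolding w'_def w''_def
    by (intro DERIV_mult DERIV_chain2[OF dg1 DERIV_exp] DERIV_exp) (use exp_mem[OF that] in auto)
  have clos: "y \<in> closure (annulus a b) \<longleftrightarrow> a \<le> norm y \<and> norm y \<le> b" for y :: "real^2"
    by (simp add: closure_annulus[OF a ab])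
  have vw: "v y = w (ln (norm y))" if "y \<in> closure (annulus a b)" for y
  proof -
    have "0 < norm y" using that a by (auto simp: clos)
    then show ?thesis unfolding w_def using that by (intro sym) (auto simp: clos ne simp del: zero_less_norm_iff)
  qed
  have ode: "w'' t = - (w t powr p)" if "ln a < t" "t < ln b" for t
  proof -
    define y where "y = exp t *\<^sub>R e"
    have y: "y \<in> annulus a b" "norm y = exp t" using ray exp_mem[OF that] by (auto simp: y_def ne)
    have "laplacian v y = w'' (ln (norm y)) / (norm y)\<^sup>2"
      by (rule radial_laplacian[OF a _ dw dw' y(1)]) (use vw closure_subset in blast)
    then show ?thesis using pde[OF y(1)] y(2) by (simp add: w_def y_def field_simps)
  qed
  have "w (ln (norm x)) = profile p (ln a) (ln b) (ln (norm x))"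
  proof (rule profile_unique[OF p])
    show "continuous_on {ln a..ln b} w"
      unfolding w_def
    proof (rule continuous_on_compose2[OF cont])
      show "(\<lambda>t. exp t *\<^sub>R e) ` {ln a..ln b} \<subseteq> closure (annulus a b)"
      proof (rule image_subsetI)
        fix t assume "t \<in> {ln a..ln b}"
        then have "exp (ln a) \<le> exp t" "exp t \<le> exp (ln b)" by simp_all
        then show "exp t *\<^sub>R e \<in> closure (annulus a b)" using a ab by (simp add: clos ne)
      qed
    qed (intro continuous_intros)
    show "w (ln a) = 0" "w (ln b) = 0"
      unfolding w_def using a ab by (auto intro!: zero simp: frontier_annulus[OF a ab] ne)
    show "0 < w t" if "ln a < t" "t < ln b" for t
      unfolding w_def by (intro pos ray exp_mem that)
    show "(w' has_real_derivative - (w t powr p)) (at t)" if "ln a < t" "t < ln b" for t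
      using dw'[OF that] ode[OF that] by simp
    show "ln (norm x) \<in> {ln a..ln b}" using x a by (auto simp: clos intro!: ln_mono)
  qed (use a ab dw in auto)
  then show ?thesis using vw[OF x] by simp
qed

section \<open>Convergence of the arch and of its height\<close>

lemma abs_sin_diff_le: "\<bar>sin x - sin y\<bar> \<le> \<bar>x - y\<bar>" for x y :: real
proof -
  have "norm (sin x - sin y) \<le> 1 * norm (x - y)"
    by (rule differentiable_bound[of UNIV sin "\<lambda>z. (*) (cos z)"])
       (auto simp: has_field_derivative_def[symmetric] intro!: DERIV_sin onorm_le
          simp: abs_mult mult_left_le_one_le)
  then show ?thesis by simp
qed

text \<open>With \<open>y = S z\<close>, the quantity \<open>z - S z = F y - y\<close> lies between its values at \<open>y = 0\<close> and \<open>y = 1\<close>.\<close>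

lemma gen_sin_near_id:
  assumes "1 < p" "0 \<le> z" "z \<le> L_const p"
  shows "\<bar>gen_sin p z - z\<bar> \<le> L_const p - 1"
  using gen_sin_mem[OF assms] gen_arcsin_gen_sin[OF assms]
    gen_arcsin_diff_mono[of p 0 "gen_sin p z"] gen_arcsin_diff_mono[of p "gen_sin p z" 1] assms
  by auto

text \<open>Likewise \<open>arcsin y - F y\<close> lies between \<open>0\<close> and \<open>pi / 2 - L\<^sub>p\<close>, and the sine is 1-Lipschitz.\<close>

lemma gen_sin_near_sin:
  assumes "1 < p" "0 \<le> z" "z \<le> L_const p"
  shows "\<bar>gen_sin p z - sin z\<bar> \<le> pi / 2 - L_const p"
proof -
  have y: "gen_sin p z \<in> {0..1}" by (rule gen_sin_mem[OF assms])
  have "\<bar>gen_sin p z - sin z\<bar> = \<bar>sin (arcsin (gen_sin p z)) - sin z\<bar>"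
    using y by simp
  also have "\<dots> \<le> \<bar>arcsin (gen_sin p z) - z\<bar>" by (rule abs_sin_diff_le)
  also have "\<dots> \<le> pi / 2 - L_const p"
    using y gen_arcsin_gen_sin[OF assms] gen_arcsin_diff_le_arcsin[of p 0 "gen_sin p z"]
      gen_arcsin_diff_le_arcsin[of p "gen_sin p z" 1] assms by auto
  finally show ?thesis .
qed

lemma gen_sin_arch_scaled:
  "1 < p \<Longrightarrow> gen_sin_arch p (2 * L_const p * \<tau>) = gen_sin p (2 * L_const p * min \<tau> (1 - \<tau>))"
  using L_const_pos[of p] by (simp add: gen_sin_arch_def min_mult_distrib_left right_diff_distrib)

text \<open>In the normalised variable \<open>\<tau> \<in> [0, 1]\<close> the arch has base \<open>2 L\<^sub>p\<close> instead of the base \<open>2\<close> of the tent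
  (below: \<open>pi\<close> for the sine); the change of scale costs the error a second time, hence the factor
  \<open>2\<close>.\<close>

lemma gen_sin_arch_near_tent:
  assumes p: "1 < p" and \<tau>: "\<tau> \<in> {0..1}"
  shows "\<bar>gen_sin_arch p (2 * L_const p * \<tau>) - 2 * min \<tau> (1 - \<tau>)\<bar> \<le> 2 * (L_const p - 1)"
proof -
  define m where "m = 2 * min \<tau> (1 - \<tau>)"
  have m: "0 \<le> m" "m \<le> 1" using \<tau> by (auto simp: m_def min_def)
  have "\<bar>gen_sin p (L_const p * m) - L_const p * m\<bar> \<le> L_const p - 1"
    by (rule gen_sin_near_id[OF p]) (use m L_const_pos[OF p] in \<open>auto intro: mult_left_le\<close>)
  moreover have "\<bar>L_const p * m - m\<bar> \<le> L_const p - 1"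
  proof -
    have "L_const p * m - m = (L_const p - 1) * m" by (simp add: algebra_simps)
    then show ?thesis using m L_const_ge_1[OF p] by (simp add: mult_left_le)
  qed
  moreover have arch: "gen_sin_arch p (2 * L_const p * \<tau>) = gen_sin p (L_const p * m)"
    unfolding gen_sin_arch_scaled[OF p] m_def by (simp only: mult_ac)
  ultimately show ?thesis
    unfolding m_def[symmetric] arch abs_le_iff by (simp only: right_diff_distrib) linarith
qed

lemma gen_sin_arch_near_sin:
  assumes p: "1 < p" and \<tau>: "\<tau> \<in> {0..1}"
  shows "\<bar>gen_sin_arch p (2 * L_const p * \<tau>) - sin (pi * \<tau>)\<bar> \<le> 2 * (pi / 2 - L_const p)"
proof -
  define m where "m = 2 * min \<tau> (1 - \<tau>)"
  have m: "0 \<le> m" "m \<le> 1" using \<tau> by (auto simp: m_def min_def)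
  have "\<bar>gen_sin p (L_const p * m) - sin (L_const p * m)\<bar> \<le> pi / 2 - L_const p"
    by (rule gen_sin_near_sin[OF p]) (use m L_const_pos[OF p] in \<open>auto intro: mult_left_le\<close>)
  moreover have "\<bar>sin (L_const p * m) - sin (pi / 2 * m)\<bar> \<le> pi / 2 - L_const p"
  proof -
    have "\<bar>sin (L_const p * m) - sin (pi / 2 * m)\<bar> \<le> \<bar>L_const p * m - pi / 2 * m\<bar>"
      by (rule abs_sin_diff_le)
    also have "\<dots> = \<bar>L_const p - pi / 2\<bar> * m"
      using m abs_mult[of "L_const p - pi / 2" m] by (simp add: left_diff_distrib)
    also have "\<dots> \<le> \<bar>L_const p - pi / 2\<bar>" using m by (intro mult_left_le) auto
    finally show ?thesis using L_const_le_pi_half[OF p] by simp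
  qed
  moreover have "sin (pi / 2 * m) = sin (pi * \<tau>)"
    using sin_pi_minus[of "pi * \<tau>"] by (simp add: m_def min_def right_diff_distrib)
  moreover have arch: "gen_sin_arch p (2 * L_const p * \<tau>) = gen_sin p (L_const p * m)"
    unfolding gen_sin_arch_scaled[OF p] m_def by (simp only: mult_ac)
  ultimately show ?thesis
    unfolding arch abs_le_iff by (simp only: right_diff_distrib) linarith
qed

lemma peak_tendsto_1:
  assumes "0 < l"
  shows "((\<lambda>p. peak p l) \<longlongrightarrow> 1) at_top"
proof -
  have e: "((\<lambda>p. 2 / (p - 1)) \<longlongrightarrow> 0) (at_top :: real filter)" by real_asymp
  have "((\<lambda>p. (2 / l) powr (2 / (p - 1))) \<longlongrightarrow> (2 / l) powr 0) at_top"
    by (intro tendsto_powr e tendsto_const) (use assms in auto)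
  moreover have "((\<lambda>p. ((p + 1) / 2) powr (1 / (p - 1))) \<longlongrightarrow> 1) (at_top :: real filter)"
    by real_asymp
  moreover have "((\<lambda>p. L_const p powr (2 / (p - 1))) \<longlongrightarrow> 1 powr 0) at_top"
    by (intro tendsto_powr e L_const_tendsto_1) auto
  ultimately have "((\<lambda>p. peak p l) \<longlongrightarrow> (2 / l) powr 0 * 1 * 1 powr 0) at_top"
    unfolding peak_def by (intro tendsto_mult)
  then show ?thesis using assms by simp
qed

lemma uniform_limitI_bound:
  assumes "\<forall>\<^sub>F p in F. \<forall>x\<in>S. dist (f p x) (l x) \<le> g p" and "(g \<longlongrightarrow> (0::real)) F"
  shows "uniform_limit S f l F"
proof (rule uniform_limitI)
  fix e :: real assume "0 < e"
  with assms(2) have "\<forall>\<^sub>F p in F. g p < e" by (rule order_tendstoD(2))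
  with assms(1) show "\<forall>\<^sub>F p in F. \<forall>x\<in>S. dist (f p x) (l x) < e"
    by eventually_elim force
qed

section \<open>Existence, uniqueness and asymptotics\<close>

theorem theorem1:
  fixes a b :: real
  assumes "0 < a" and "a < b"
  shows "\<exists>u :: real \<Rightarrow> real^2 \<Rightarrow> real.
    (\<forall>p>1. radial_solution a b p (u p) \<and>
       (\<forall>v. radial_solution a b p v \<longrightarrow> (\<forall>x\<in>closure (annulus a b). v x = u p x))) \<and>
    uniform_limit (closure (annulus a b)) u
      (\<lambda>x. 2 / (ln b - ln a) *
         (if norm x \<le> sqrt (a * b) then ln (norm x) - ln a else ln b - ln (norm x))) at_top \<and>
    (\<exists>\<epsilon> :: real \<Rightarrow> real^2 \<Rightarrow> real.
       uniform_limit (closure (annulus a b)) \<epsilon> (\<lambda>x. 0) (at_right 1) \<and>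
       (\<forall>p>1. \<forall>x\<in>closure (annulus a b).
          u p x = (2 / (ln b - ln a)) powr (2 / (p - 1)) * ((p + 1) / 2) powr (1 / (p - 1)) *
            L_const p powr (2 / (p - 1)) *
            (sin (pi * (ln b - ln (norm x)) / (ln b - ln a)) + \<epsilon> p x)))"
proof -
  let ?A = "closure (annulus a b)" and ?l = "ln b - ln a"
  \<comment> \<open>\<open>\<tau>\<close> is the position of \<open>ln |x|\<close> within \<open>[ln a, ln b]\<close>, normalised to \<open>[0, 1]\<close>.\<close>
  define \<tau> where "\<tau> = (\<lambda>x :: real^2. (ln (norm x) - ln a) / ?l)"
  define u where "u = (\<lambda>p (x :: real^2). profile p (ln a) (ln b) (ln (norm x)))"
  define S where "S = (\<lambda>p x. gen_sin_arch p (2 * L_const p * \<tau> x))"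
  define \<epsilon> where "\<epsilon> = (\<lambda>p x. S p x - sin (pi * (ln b - ln (norm x)) / ?l))"
  have l: "0 < ?l" using assms by simp
  have uS: "u p x = peak p ?l * S p x" for p x
    by (simp add: u_def S_def profile_def \<tau>_def)
  have norm_x: "a \<le> norm x" "norm x \<le> b" if "x \<in> ?A" for x
    using that by (auto simp: closure_annulus[OF assms])
  have \<tau>: "\<tau> x \<in> {0..1}" if "x \<in> ?A" for x
  proof -
    have "ln a \<le> ln (norm x)" "ln (norm x) \<le> ln b"
      using norm_x[OF that] assms by (auto intro!: ln_mono)
    then show ?thesis using l by (simp add: \<tau>_def)
  qed
  have compl: "1 - \<tau> x = (ln b - ln (norm x)) / ?l" for x
    using l by (simp add: \<tau>_def field_simps)
  have S01: "S p x \<in> {0..1}" if "x \<in> ?A" "1 < p" for p x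
    unfolding S_def using \<tau>[OF that(1)] L_const_pos[OF that(2)]
    by (intro gen_sin_arch_mem[OF that(2)]) (auto intro: mult_left_le)
  have tent: "2 / ?l * (if norm x \<le> sqrt (a * b) then ln (norm x) - ln a else ln b - ln (norm x))
      = 2 * min (\<tau> x) (1 - \<tau> x)" if x: "x \<in> ?A" for x
  proof -
    have "norm x \<le> sqrt (a * b) \<longleftrightarrow> ln (norm x) \<le> ln (sqrt (a * b))"
      using norm_x[OF x] assms by (intro ln_le_cancel_iff[symmetric]) auto
    also have "ln (sqrt (a * b)) = (ln a + ln b) / 2"
      using assms by (simp add: ln_sqrt ln_mult)
    also have "ln (norm x) \<le> (ln a + ln b) / 2 \<longleftrightarrow> \<tau> x \<le> 1 - \<tau> x"
      unfolding compl using l by (simp add: \<tau>_def divide_le_cancel) linarith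
    finally show ?thesis by (simp add: compl min_def) (simp add: \<tau>_def)
  qed
  have "radial_solution a b p (u p) \<and>
      (\<forall>v. radial_solution a b p v \<longrightarrow> (\<forall>x\<in>?A. v x = u p x))" if "1 < p" for p
    unfolding u_def
    using profile_is_radial_solution[OF assms that] radial_solution_is_profile[OF assms that] by blast
  moreover have "uniform_limit ?A u (\<lambda>x. 2 / ?l *
      (if norm x \<le> sqrt (a * b) then ln (norm x) - ln a else ln b - ln (norm x))) at_top"
  proof (rule uniform_limitI_bound)
    show "\<forall>\<^sub>F p in at_top. \<forall>x\<in>?A. dist (u p x) (2 / ?l *
        (if norm x \<le> sqrt (a * b) then ln (norm x) - ln a else ln b - ln (norm x)))
        \<le> \<bar>peak p ?l - 1\<bar> + 2 * (L_const p - 1)"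
      using eventually_gt_at_top[of "1::real"]
    proof (eventually_elim, intro ballI)
      fix p :: real and x assume p: "1 < p" and x: "x \<in> ?A"
      define m where "m = 2 * min (\<tau> x) (1 - \<tau> x)"
      have "\<bar>u p x - m\<bar> = \<bar>(peak p ?l - 1) * S p x + (S p x - m)\<bar>"
        by (simp add: uS algebra_simps)
      also have "\<dots> \<le> \<bar>peak p ?l - 1\<bar> * S p x + \<bar>S p x - m\<bar>"
        using S01[OF x p] abs_triangle_ineq[of "(peak p ?l - 1) * S p x" "S p x - m"]
        by (simp add: abs_mult)
      also have "\<dots> \<le> \<bar>peak p ?l - 1\<bar> + 2 * (L_const p - 1)"
        using S01[OF x p] gen_sin_arch_near_tent[OF p \<tau>[OF x]]
        by (intro add_mono mult_left_le) (auto simp: S_def m_def)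
      finally show "dist (u p x) (2 / ?l *
          (if norm x \<le> sqrt (a * b) then ln (norm x) - ln a else ln b - ln (norm x)))
          \<le> \<bar>peak p ?l - 1\<bar> + 2 * (L_const p - 1)"
        unfolding tent[OF x] by (simp add: dist_real_def m_def)
    qed
    have "((\<lambda>p. \<bar>peak p ?l - 1\<bar> + 2 * (L_const p - 1)) \<longlongrightarrow> \<bar>1 - 1\<bar> + 2 * (1 - 1)) at_top"
      by (intro tendsto_intros peak_tendsto_1 L_const_tendsto_1 l)
    then show "((\<lambda>p. \<bar>peak p ?l - 1\<bar> + 2 * (L_const p - 1)) \<longlongrightarrow> 0) at_top" by simp
  qed
  moreover have "uniform_limit ?A \<epsilon> (\<lambda>x. 0) (at_right 1)"
  proof (rule uniform_limitI_bound)
    show "\<forall>\<^sub>F p in at_right 1. \<forall>x\<in>?A. dist (\<epsilon> p x) 0 \<le> 2 * (pi / 2 - L_const p)"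
      using eventually_at_right_less[of "1::real"]
    proof (eventually_elim, intro ballI)
      fix p :: real and x assume p: "1 < p" and x: "x \<in> ?A"
      have "pi * (ln b - ln (norm x)) / ?l = pi - pi * \<tau> x"
        unfolding times_divide_eq_right[symmetric] compl[symmetric] by (simp add: right_diff_distrib)
      then have "sin (pi * (ln b - ln (norm x)) / ?l) = sin (pi * \<tau> x)" by simp
      then show "dist (\<epsilon> p x) 0 \<le> 2 * (pi / 2 - L_const p)"
        using gen_sin_arch_near_sin[OF p \<tau>[OF x]] by (simp add: \<epsilon>_def S_def)
    qed
    have "((\<lambda>p. 2 * (pi / 2 - L_const p)) \<longlongrightarrow> 2 * (pi / 2 - pi / 2)) (at_right 1)"
      by (intro tendsto_intros L_const_tendsto_pi_half)
    then show "((\<lambda>p. 2 * (pi / 2 - L_const p)) \<longlongrightarrow> 0) (at_right 1)" by simp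
  qed
  moreover have "u p x = (2 / ?l) powr (2 / (p - 1)) * ((p + 1) / 2) powr (1 / (p - 1)) *
      L_const p powr (2 / (p - 1)) * (sin (pi * (ln b - ln (norm x)) / ?l) + \<epsilon> p x)" for p x
    unfolding uS peak_def \<epsilon>_def by simp
  ultimately show ?thesis by blast
qed

end
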